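(* Let $d\ge 2$ and $K,N,M\in\mathbb{N}$ with $M\le K$. Let $$P(\mathbf{x})=\sum_{\mathbf{k}\in(\mathbb{Z}\cap[-K,K])^d} c_{\mathbf{k}}e^{2\pi i\mathbf{k}\cdot\mathbf{x}/N},\qquad\mathbf{x}\in\mathbb{R}^d,$$ be a real-valued trigonometric polynomial with $c_{\mathbf{k}}=\frac{1}{N^d}\delta_{\mathbf{k},\mathbf{0}}$ for all $\mathbf{k}\in(N\mathbb{Z})^d$ and with $P\chi_{[0,N]^d}\in C^{2M-1}(\mathbb{R}^d)$. Suppose $P(\mathbf{x})=\prod_{j=1}^d\sin^{2M}(\pi x_j/N)\,G(\mathbf{x})H(\mathbf{x})$ for some $(N\mathbb{Z})^d$-periodic real-valued trigonometric polynomials $G,H$. Let $B$ be a real invertible $d\times d$ matrix such that $(B^T)^{-1}\mathbf{n}\notin(-N,N)^d$ for all $\mathbf{n}\in\mathbb{Z}^d\setminus\{\mathbf{0}\}$. Define $$g(\mathbf{x})=\Big(\prod_{j=1}^d\sin^M(\pi x_j/N)\Big)G(\mathbf{x})\chi_{[0,N]^d}(\mathbf{x}),\qquad h(\mathbf{x})=|\det B|\Big(\prod_{j=1}^d\sin^M(\pi x_j/N)\Big)H(\mathbf{x})\chi_{[0,N]^d}(\mathbf{x}).$$ Then $g,h\in C^{M-1}(\mathbb{R}^d)$, and the Gabor systems $\{E_{B\mathbf{m}}T_{\mathbf{n}}g\}_{\mathbf{m},\mathbf{n}\in\mathbb{Z}^d}$ and $\{E_{B\mathbf{m}}T_{\mathbf{n}}h\}_{\mathbf{m},\mathbf{n}\in\mathbb{Z}^d}$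 form dual frames for $L^2(\mathbb{R}^d)$.
   Context: An $(N\mathbb{Z})^d$-periodic trigonometric polynomial is a finite sum $\sum_{\mathbf{k}} a_{\mathbf{k}}e^{2\pi i\mathbf{k}\cdot\mathbf{x}/N}$, $\mathbf{k}\in\mathbb{Z}^d$. For $\mathbf{y}\in\mathbb{R}^d$, $(T_{\mathbf{y}}f)(\mathbf{x})=f(\mathbf{x}-\mathbf{y})$ and $(E_{\mathbf{y}}f)(\mathbf{x})=e^{2\pi i\mathbf{y}\cdot\mathbf{x}}f(\mathbf{x})$ on $L^2(\mathbb{R}^d)$. Two Bessel sequences $\{f_i\}$, $\{h_i\}$ in a Hilbert space $\mathcal H$ are dual frames if $f=\sum_i\langle f,h_i\rangle f_i$ for all $f\in\mathcal H$. $C^m(\mathbb{R}^d)$ denotes functions with continuous partial derivatives of total order at most $m$; $\chi_{[0,N]^d}$ is the indicator of $[0,N]^d$. *)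

theory Defs
  imports "HOL-Analysis.Analysis"
begin

definition Zvec :: "(real^'d) set" where
  "Zvec = {v. \<forall>j. v $ j \<in> \<int>}"

definition trig_term :: "nat \<Rightarrow> real^'d \<Rightarrow> real^'d \<Rightarrow> complex" where
  "trig_term N k x = exp (2 * pi * \<i> * complex_of_real (k \<bullet> x / real N))"

definition is_real_trig_poly :: "nat \<Rightarrow> (real^'d \<Rightarrow> real) \<Rightarrow> bool" where
  "is_real_trig_poly N G =
     (\<exists>S a. finite S \<and> S \<subseteq> Zvec \<and>
        (\<forall>x. complex_of_real (G x) = (\<Sum>k\<in>S. a k * trig_term N k x)))"

fun Ck :: "nat \<Rightarrow> (real^'d \<Rightarrow> real) \<Rightarrow> bool" where
  "Ck 0 f = continuous_on UNIV f"
| "Ck (Suc m) f = (continuous_on UNIV f \<and>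
      (\<forall>i. \<exists>g. (\<forall>x. ((\<lambda>t. f (x + t *\<^sub>R axis i 1)) has_real_derivative g x) (at 0)) \<and> Ck m g))"

definition L2 :: "(real^'d \<Rightarrow> complex) set" where
  "L2 = {f. f \<in> borel_measurable lebesgue \<and> integrable lebesgue (\<lambda>x. (norm (f x))\<^sup>2)}"

definition L2_inner :: "(real^'d \<Rightarrow> complex) \<Rightarrow> (real^'d \<Rightarrow> complex) \<Rightarrow> complex" where
  "L2_inner f g = (LINT x|lebesgue. f x * cnj (g x))"

definition L2_norm :: "(real^'d \<Rightarrow> complex) \<Rightarrow> real" where
  "L2_norm f = sqrt (LINT x|lebesgue. (norm (f x))\<^sup>2)"

definition bessel_seq :: "'i set \<Rightarrow> ('i \<Rightarrow> real^'d \<Rightarrow> complex) \<Rightarrow> bool" where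
  "bessel_seq I fs =
     ((\<forall>i\<in>I. fs i \<in> L2) \<and>
      (\<exists>C. \<forall>f\<in>L2. (\<lambda>i. (norm (L2_inner f (fs i)))\<^sup>2) summable_on I \<and>
                  (\<Sum>\<^sub>\<infinity>i\<in>I. (norm (L2_inner f (fs i)))\<^sup>2) \<le> C * (L2_norm f)\<^sup>2))"

definition dual_frames :: "'i set \<Rightarrow> ('i \<Rightarrow> real^'d \<Rightarrow> complex) \<Rightarrow> ('i \<Rightarrow> real^'d \<Rightarrow> complex) \<Rightarrow> bool" where
  "dual_frames I fs hs =
     (bessel_seq I fs \<and> bessel_seq I hs \<and>
      (\<forall>f\<in>L2. \<forall>e>0. \<exists>F0. finite F0 \<and> F0 \<subseteq> I \<and>
         (\<forall>S. finite S \<and> F0 \<subseteq> S \<and> S \<subseteq> I \<longrightarrow>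
            L2_norm (\<lambda>x. f x - (\<Sum>i\<in>S. L2_inner f (hs i) * fs i x)) < e)))"

definition transl :: "real^'d \<Rightarrow> (real^'d \<Rightarrow> complex) \<Rightarrow> real^'d \<Rightarrow> complex" where
  "transl y f = (\<lambda>x. f (x - y))"

definition modul :: "real^'d \<Rightarrow> (real^'d \<Rightarrow> complex) \<Rightarrow> real^'d \<Rightarrow> complex" where
  "modul y f = (\<lambda>x. exp (2 * pi * \<i> * complex_of_real (y \<bullet> x)) * f x)"

definition gabor :: "real^'d^'d \<Rightarrow> (real^'d \<Rightarrow> complex) \<Rightarrow> (real^'d) \<times> (real^'d) \<Rightarrow> real^'d \<Rightarrow> complex" where
  "gabor B g = (\<lambda>(m, n). modul (B *v m) (transl n g))"

end

theory Submission
  imports Defs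
begin

text \<open>
  The hypothesis on \<open>B\<close> says that the translates of the open cube \<open>(0, N)\<^sup>d\<close> by the lattice dual
  to \<open>B \<int>\<^sup>d\<close> are pairwise disjoint. Hence a function supported in a translate of that cube can be
  periodized without overlap, and Parseval's identity for Fourier series on the torus gives
  \<open>\<Sum>\<^sub>m \<langle>F, e\<^bsub>Bm\<^esub>\<rangle> \<langle>e\<^bsub>Bm\<^esub>, U\<rangle> = \<langle>F, U\<rangle> / \<bar>det B\<bar>\<close> for \<open>F = f \<cdot> T\<^sub>n h\<close> and \<open>U = u \<cdot> T\<^sub>n g\<close>.
  Summing over \<open>n\<close> reduces everything to the sums \<open>\<Sum>\<^sub>n \<bar>g (x - n)\<bar>\<^sup>2\<close>, which are bounded (Bessel
  property), and \<open>\<Sum>\<^sub>n (g h) (x - n) = \<bar>det B\<bar> \<Sum>\<^sub>n (P \<chi>) (x - n) = \<bar>det B\<bar>\<close> (weak reconstruction),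
  where the last equality is a discrete orthogonality relation and uses the condition on the
  coefficients of \<open>P\<close>. For Bessel sequences weak reconstruction implies norm convergence.
  The smoothness of \<open>g\<close> and \<open>h\<close> comes from the zeros of order \<open>M\<close> of the sine factors on the
  boundary of the cube.
\<close>

subsection \<open>Differentiability of truncated trigonometric polynomials\<close>

text \<open>The hypothesis on \<open>B\<close> concerns the open cube \<open>(-N, N)^d\<close>,
  while the windows are cut off to the closed cube. The zeros of the sine factors close this gap:
  since \<open>M \<ge> 1\<close>, both windows vanish on the boundary and live on the open cube, any
  two points of which differ by a vector in \<open>(-N, N)^d\<close>. The substitution
  \<open>x = (B^T)^{-1} y\<close> turns the frequencies \<open>B m\<close> into \<open>m\<close> and
  the dual lattice into the integer lattice, so only Fourier series of period 1 are needed. Their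
  completeness comes from Stone-Weierstrass on the torus, after square-integrable functions have
  been reduced to continuous ones that vanish on the faces of the unit cube. The sum over all pairs
  \<open>(m, n)\<close> may be taken first in \<open>m\<close> and then in \<open>n\<close>, because
  the Bessel bounds of the two systems make it absolutely convergent. Discrete orthogonality enters
  because the integer translates of the cube that meet a point correspond to the residues modulo
  \<open>N\<close>; summing a character over them keeps only the frequencies in
  \<open>(N Z)^d\<close>, where the coefficients of \<open>P\<close> are prescribed.\<close>

inductive trig_alg :: "(real^'d \<Rightarrow> real) \<Rightarrow> bool" where
  const: "trig_alg (\<lambda>x. c)"
| cos: "trig_alg (\<lambda>x. cos (v \<bullet> x + t))"
| add: "trig_alg f \<Longrightarrow> trig_alg g \<Longrightarrow> trig_alg (\<lambda>x. f x + g x)"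
| mult: "trig_alg f \<Longrightarrow> trig_alg g \<Longrightarrow> trig_alg (\<lambda>x. f x * g x)"

lemma trig_alg_sum: "(\<And>i. i \<in> S \<Longrightarrow> trig_alg (f i)) \<Longrightarrow> trig_alg (\<lambda>x. \<Sum>i\<in>S. f i x)"
  by (induction S rule: infinite_finite_induct) (auto intro: trig_alg.intros)

lemma trig_alg_prod: "(\<And>i. i \<in> S \<Longrightarrow> trig_alg (f i)) \<Longrightarrow> trig_alg (\<lambda>x. \<Prod>i\<in>S. f i x)"
  by (induction S rule: infinite_finite_induct) (auto intro: trig_alg.intros)

lemma trig_alg_power: "trig_alg f \<Longrightarrow> trig_alg (\<lambda>x. f x ^ n)"
  by (induction n) (auto intro: trig_alg.intros)

lemma trig_alg_sin: "trig_alg (\<lambda>x. sin (v \<bullet> x))"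
proof -
  have "(\<lambda>x. sin (v \<bullet> x)) = (\<lambda>x. cos (v \<bullet> x + (-pi/2)))"
    by (simp add: fun_eq_iff cos_diff)
  then show ?thesis by (metis trig_alg.cos)
qed

lemma continuous_on_trig_alg: "trig_alg f \<Longrightarrow> continuous_on S f"
  by (induction rule: trig_alg.induct) (auto intro!: continuous_intros)

text \<open>The free phase in the generators \<open>cos (v \<bullet> x + t)\<close> makes the class
  closed under differentiation: the derivative of a cosine is a multiple of a cosine shifted by
  \<open>pi/2\<close>.\<close>

lemma trig_alg_partial:
  "trig_alg f \<Longrightarrow> \<exists>D. trig_alg D \<and>
     (\<forall>x. ((\<lambda>t. f (x + t *\<^sub>R axis i 1)) has_real_derivative D x) (at 0))"
proof (induction rule: trig_alg.induct)
  case (const c)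
  show ?case by (intro exI[of _ "\<lambda>x. 0"]) (auto intro: trig_alg.const)
next
  case (cos v t)
  have "trig_alg (\<lambda>x. - (v $ i) * cos (v \<bullet> x + (t - pi/2)))"
    by (intro trig_alg.intros)
  moreover have "((\<lambda>s. cos (v \<bullet> (x + s *\<^sub>R axis i 1) + t)) has_real_derivative
      - (v $ i) * cos (v \<bullet> x + (t - pi/2))) (at 0)" for x
    by (auto intro!: derivative_eq_intros simp: inner_add_right inner_axis cos_diff sin_add cos_add
        algebra_simps)
  ultimately show ?case by blast
next
  case (add f g)
  then obtain D E where "trig_alg D" "trig_alg E"
    and "\<And>x. ((\<lambda>t. f (x + t *\<^sub>R axis i 1)) has_real_derivative D x) (at 0)"
    and "\<And>x. ((\<lambda>t. g (x + t *\<^sub>R axis i 1)) has_real_derivative E x) (at 0)" by blast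
  then show ?case
    by (intro exI[of _ "\<lambda>x. D x + E x"]) (auto intro!: trig_alg.intros derivative_eq_intros)
next
  case (mult f g)
  then obtain D E where "trig_alg D" "trig_alg E"
    and "\<And>x. ((\<lambda>t. f (x + t *\<^sub>R axis i 1)) has_real_derivative D x) (at 0)"
    and "\<And>x. ((\<lambda>t. g (x + t *\<^sub>R axis i 1)) has_real_derivative E x) (at 0)" by blast
  with mult show ?case
    by (intro exI[of _ "\<lambda>x. D x * g x + E x * f x"])
      (auto intro!: trig_alg.intros derivative_eq_intros)
qed

text \<open>A real-valued sum equals its real part, which is a real combination of cosines and
  sines; no conjugate symmetry of the coefficients has to be extracted.\<close>

lemma trig_alg_real_trig_poly:
  assumes "is_real_trig_poly N G"
  shows "trig_alg G"
proof -
  obtain S a where S: "\<And>x. complex_of_real (G x) = (\<Sum>k\<in>S. a k * trig_term N k x)"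
    using assms unfolding is_real_trig_poly_def by blast
  have tt: "trig_term N k x = cis (((2 * pi / real N) *\<^sub>R k) \<bullet> x)" for k x
    by (simp add: trig_term_def cis_conv_exp mult_ac)
  have "G x = Re (\<Sum>k\<in>S. a k * trig_term N k x)" for x
    by (metis S Re_complex_of_real)
  then have "G x = (\<Sum>k\<in>S. Re (a k) * cos (((2 * pi / real N) *\<^sub>R k) \<bullet> x + 0)
      + (- Im (a k)) * sin (((2 * pi / real N) *\<^sub>R k) \<bullet> x))" for x
    by (simp add: tt)
  then have "G = (\<lambda>x. (\<Sum>k\<in>S. Re (a k) * cos (((2 * pi / real N) *\<^sub>R k) \<bullet> x + 0)
      + (- Im (a k)) * sin (((2 * pi / real N) *\<^sub>R k) \<bullet> x)))" by blast
  moreover have "trig_alg \<dots>"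
    by (intro trig_alg_sum trig_alg.add trig_alg.mult trig_alg.const trig_alg.cos trig_alg_sin)
  ultimately show ?thesis by simp
qed

text \<open>Away from the endpoints the truncated function agrees locally with \<open>0\<close> or
  with \<open>u\<close>. At an endpoint its difference quotient is dominated by that of
  \<open>u\<close>, which tends to \<open>0\<close> there.\<close>

lemma has_real_derivative_cutoff:
  fixes u u' :: "real \<Rightarrow> real"
  assumes der: "\<And>s. (u has_real_derivative u' s) (at s)"
    and "a < b" "u a = 0" "u b = 0" "u' a = 0" "u' b = 0"
  shows "((\<lambda>s. u s * indicator {a..b} s) has_real_derivative (u' s * indicator {a..b} s)) (at s)"
proof -
  let ?f = "\<lambda>s. u s * indicator {a..b} s :: real"
  consider "s < a" | "s = a" | "a < s" "s < b" | "s = b" | "s > b" by linarith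
  then show ?thesis
  proof cases
    case 1
    have "(?f has_real_derivative 0) (at s)"
      by (rule DERIV_cong_ev[THEN iffD2, OF refl _ refl, of _ "\<lambda>_. 0"])
        (use 1 in \<open>auto intro!: eventually_mono[OF eventually_nhds_in_open[of "{..<a}"]]\<close>)
    then show ?thesis using 1 by simp
  next
    case 5
    have "(?f has_real_derivative 0) (at s)"
      by (rule DERIV_cong_ev[THEN iffD2, OF refl _ refl, of _ "\<lambda>_. 0"])
        (use 5 in \<open>auto intro!: eventually_mono[OF eventually_nhds_in_open[of "{b<..}"]]\<close>)
    then show ?thesis using 5 by simp
  next
    case 3
    have "(?f has_real_derivative u' s) (at s)"
      by (rule DERIV_cong_ev[THEN iffD2, OF refl _ refl der])
        (use 3 in \<open>auto intro!: eventually_mono[OF eventually_nhds_in_open[of "{a<..<b}"]]\<close>)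
    then show ?thesis using 3 by simp
  next
    case 2
    have "norm (?f y) \<le> norm (u y)" for y by (auto simp: indicator_def)
    moreover have "((\<lambda>y. u y / (y - a)) \<longlongrightarrow> 0) (at a)"
      using der[of a] assms by (simp add: has_field_derivative_iff)
    ultimately have "((\<lambda>y. ?f y / (y - a)) \<longlongrightarrow> 0) (at a)"
      by (elim Lim_null_comparison[rotated, OF tendsto_norm_zero])
        (auto intro!: always_eventually divide_right_mono simp: norm_divide)
    then show ?thesis using 2 assms by (simp add: has_field_derivative_iff)
  next
    case 4
    have "norm (?f y) \<le> norm (u y)" for y by (auto simp: indicator_def)
    moreover have "((\<lambda>y. u y / (y - b)) \<longlongrightarrow> 0) (at b)"
      using der[of b] assms by (simp add: has_field_derivative_iff)
    ultimately have "((\<lambda>y. ?f y / (y - b)) \<longlongrightarrow> 0) (at b)"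
      by (elim Lim_null_comparison[rotated, OF tendsto_norm_zero])
        (auto intro!: always_eventually divide_right_mono simp: norm_divide)
    then show ?thesis using 4 assms by (simp add: has_field_derivative_iff)
  qed
qed

text \<open>Truncation equals composition with the coordinatewise clamp onto the cube: a point
  outside is clamped to a face, where \<open>w\<close> vanishes.\<close>

lemma continuous_on_cutoff:
  fixes w :: "real^'d \<Rightarrow> real"
  assumes w: "continuous_on UNIV w" and "N \<ge> 0"
    and zero: "\<And>x j. x $ j = 0 \<or> x $ j = N \<Longrightarrow> w x = 0"
  shows "continuous_on UNIV (\<lambda>x. w x * indicator (cbox 0 (\<chi> j. N)) x)"
proof -
  let ?c = "\<lambda>x::real^'d. (\<chi> j. max 0 (min N (x $ j)))"
  have "w x * indicator (cbox 0 (\<chi> j. N)) x = w (?c x)" for x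
  proof (cases "x \<in> cbox 0 (\<chi> j. N)")
    case True
    then have "?c x = x" by (auto simp: mem_box_cart vec_eq_iff)
    then show ?thesis using True by simp
  next
    case False
    then obtain j where "\<not> (0 \<le> x $ j \<and> x $ j \<le> N)" by (auto simp: mem_box_cart)
    then have "?c x $ j = 0 \<or> ?c x $ j = N" using \<open>N \<ge> 0\<close> by auto
    then show ?thesis using zero False by (simp add: \<open>\<not> (0 \<le> x $ j \<and> x $ j \<le> N)\<close>)
  qed
  moreover have "continuous_on UNIV (\<lambda>x. w (?c x))"
    by (rule continuous_on_compose2[OF w]) (auto intro!: continuous_intros)
  ultimately show ?thesis by (simp cong: continuous_on_cong)
qed

lemma trig_alg_sin_prod:
  "trig_alg T \<Longrightarrow> trig_alg (\<lambda>x::real^'d. (\<Prod>j\<in>UNIV. sin (pi * x $ j / N) ^ a j) * T x)"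
proof (intro trig_alg.mult trig_alg_prod trig_alg_power)
  show "trig_alg (\<lambda>x::real^'d. sin (pi * x $ j / N))" for j
    using trig_alg_sin[of "axis j (pi / N)"] by (simp add: inner_axis' mult_ac)
qed

lemma sin_prod_eq_0:
  assumes "x $ j = 0 \<or> x $ j = N" "a j \<ge> Suc 0" "N > 0"
  shows "(\<Prod>j\<in>UNIV. sin (pi * x $ j / N) ^ a j) = (0::real)"
proof -
  have "sin (pi * x $ j / N) ^ a j = 0" using assms by auto
  then show ?thesis by (metis (mono_tags, lifting) UNIV_I finite prod_zero)
qed

text \<open>With \<open>s\<close> the i-th sine, \<open>(s^a T)' = s^(a-1) (a s' T + s T')\<close>.
  One factor \<open>s\<close> is lost and the bracket is again in \<open>trig_alg\<close>, so the
  shape survives with only the i-th exponent lowered.\<close>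

lemma sin_prod_partial:
  fixes T :: "real^'d \<Rightarrow> real"
  assumes "trig_alg T" "N > 0" "a i \<ge> 1"
  shows "\<exists>T'. trig_alg T' \<and> (\<forall>x.
      ((\<lambda>t. (\<Prod>j\<in>UNIV. sin (pi * (x + t *\<^sub>R axis i 1) $ j / N) ^ a j) * T (x + t *\<^sub>R axis i 1))
        has_real_derivative (\<Prod>j\<in>UNIV. sin (pi * x $ j / N) ^ (a(i := a i - 1)) j) * T' x) (at 0))"
proof -
  obtain D where D: "trig_alg D"
    "\<And>x. ((\<lambda>t. T (x + t *\<^sub>R axis i 1)) has_real_derivative D x) (at 0)"
    using trig_alg_partial[OF assms(1)] by blast
  define T' where "T' = (\<lambda>x. (real (a i) * (pi / N)) * cos (axis i (pi / N) \<bullet> x + 0) * T x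
     + sin (axis i (pi / N) \<bullet> x) * D x)"
  have T': "trig_alg T'" unfolding T'_def
    by (intro trig_alg.add trig_alg.mult trig_alg.const trig_alg.cos trig_alg_sin assms D(1))
  have "((\<lambda>t. (\<Prod>j\<in>UNIV. sin (pi * (x + t *\<^sub>R axis i 1) $ j / N) ^ a j) * T (x + t *\<^sub>R axis i 1))
        has_real_derivative (\<Prod>j\<in>UNIV. sin (pi * x $ j / N) ^ (a(i := a i - 1)) j) * T' x) (at 0)" for x
  proof -
    define R where "R = (\<Prod>j\<in>UNIV - {i}. sin (pi * x $ j / N) ^ a j)"
    have 1: "(\<Prod>j\<in>UNIV. sin (pi * (x + t *\<^sub>R axis i 1) $ j / N) ^ a j)
        = sin (pi * (x $ i + t) / N) ^ a i * R" for t
      unfolding R_def by (subst prod.remove[of _ i]) (auto simp: axis_def intro!: prod.cong)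
    have 2: "(\<Prod>j\<in>UNIV. sin (pi * x $ j / N) ^ (a(i := a i - 1)) j)
        = sin (pi * x $ i / N) ^ (a i - 1) * R"
      unfolding R_def by (subst prod.remove[of _ i]) (auto intro!: prod.cong)
    have 3: "sin (pi * x $ i / N) ^ a i = sin (pi * x $ i / N) ^ (a i - 1) * sin (pi * x $ i / N)"
      using assms(3) by (metis power_minus_mult zero_less_one less_le_trans)
    show ?thesis unfolding 1 2
      using \<open>N > 0\<close> by (auto intro!: derivative_eq_intros D(2) simp: T'_def inner_axis' 3 field_simps)
  qed
  with T' show ?thesis by blast
qed

lemma has_real_derivative_cutoff_cbox:
  fixes w w' :: "real^'d \<Rightarrow> real"
  assumes der: "\<And>x. ((\<lambda>t. w (x + t *\<^sub>R axis i 1)) has_real_derivative w' x) (at 0)"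
    and "N > 0" and "\<And>x. x $ i = 0 \<or> x $ i = N \<Longrightarrow> w x = 0 \<and> w' x = 0"
  shows "((\<lambda>t. w (x + t *\<^sub>R axis i 1) * indicator (cbox 0 (\<chi> j. N)) (x + t *\<^sub>R axis i 1))
     has_real_derivative (w' x * indicator (cbox 0 (\<chi> j. N)) x)) (at 0)"
proof -
  \<comment> \<open>The line in direction i is parametrised by its i-th coordinate. Along it the
    indicator of the cube is that of \<open>{0..N}\<close> times the constant \<open>c\<close>,
    which reduces the claim to one variable.\<close>
  define y where "y = (\<lambda>s. x + (s - x $ i) *\<^sub>R axis i (1::real))"
  define c where "c = (if \<forall>j. j \<noteq> i \<longrightarrow> 0 \<le> x $ j \<and> x $ j \<le> N then 1 else 0 :: real)"
  have yi: "y s $ j = (if j = i then s else x $ j)" for s j by (simp add: y_def axis_def)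
  have ind: "indicator (cbox 0 (\<chi> j. N)) (y s) = indicator {0..N} s * c" for s
    by (auto simp: indicator_def mem_box_cart yi c_def)
  have "((\<lambda>s. w (y s)) has_real_derivative w' (y s)) (at s)" for s
  proof -
    have "y s + t *\<^sub>R axis i 1 = y (t + s)" for t by (simp add: y_def algebra_simps)
    then show ?thesis using der[of "y s"] DERIV_shift[of "\<lambda>s. w (y s)" "w' (y s)" 0 s] by simp
  qed
  then have "((\<lambda>s. w (y s) * indicator {0..N} s) has_real_derivative
      w' (y (x $ i)) * indicator {0..N} (x $ i)) (at (x $ i))"
    using assms yi by (intro has_real_derivative_cutoff) auto
  from DERIV_cmult_right[OF this, of c]
  have "((\<lambda>s. w (y s) * indicator (cbox 0 (\<chi> j. N)) (y s)) has_real_derivative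
      w' (y (x $ i)) * indicator (cbox 0 (\<chi> j. N)) (y (x $ i))) (at (0 + x $ i))"
    by (simp add: ind mult.assoc)
  then show ?thesis
    unfolding DERIV_shift by (simp add: y_def)
qed

text \<open>Induction on the order with the exponents generalised, since differentiating in
  direction i lowers the i-th one alone. In the inductive step that exponent is at least 2, so
  function and derivative both vanish on the faces \<open>x $ i = 0\<close> and
  \<open>x $ i = N\<close>.\<close>

lemma Ck_sin_prod_cutoff:
  fixes T :: "real^'d \<Rightarrow> real"
  assumes "trig_alg T" "N > 0" "\<And>j. a j \<ge> Suc m"
  shows "Ck m (\<lambda>x. (\<Prod>j\<in>UNIV. sin (pi * x $ j / N) ^ a j) * T x * indicator (cbox 0 (\<chi> j. N)) x)"
  using assms
proof (induction m arbitrary: T a)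
  case 0
  have "continuous_on UNIV (\<lambda>x. (\<Prod>j\<in>UNIV. sin (pi * x $ j / N) ^ a j) * T x * indicator (cbox 0 (\<chi> j. N)) x)"
    using 0 sin_prod_eq_0[of _ _ N a]
    by (intro continuous_on_cutoff continuous_on_trig_alg trig_alg_sin_prod) auto
  then show ?case by simp
next
  case (Suc m)
  let ?ch = "indicator (cbox 0 (\<chi> j. N)) :: real^'d \<Rightarrow> real"
  let ?w = "\<lambda>a T x. (\<Prod>j\<in>UNIV. sin (pi * x $ j / N) ^ a j) * T x"
  have a1: "a j \<ge> Suc 0" "a j \<ge> 2" "a j \<ge> Suc m" for j
    using Suc.prems(3)[of j] by auto
  have "continuous_on UNIV (\<lambda>x. ?w a T x * ?ch x)"
    using Suc.prems a1 sin_prod_eq_0[of _ _ N a]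
    by (intro continuous_on_cutoff continuous_on_trig_alg trig_alg_sin_prod) auto
  moreover have "\<exists>g. (\<forall>x. ((\<lambda>t. ?w a T (x + t *\<^sub>R axis i 1) * ?ch (x + t *\<^sub>R axis i 1))
           has_real_derivative g x) (at 0)) \<and> Ck m g" for i
  proof -
    let ?a = "a(i := a i - 1)"
    obtain T' where T': "trig_alg T'"
      "\<And>x. ((\<lambda>t. ?w a T (x + t *\<^sub>R axis i 1)) has_real_derivative ?w ?a T' x) (at 0)"
      using sin_prod_partial[OF Suc.prems(1,2), of a i] a1[of i] by auto
    have z: "?w a T x = 0 \<and> ?w ?a T' x = 0" if "x $ i = 0 \<or> x $ i = N" for x
      using sin_prod_eq_0[of x i N a] sin_prod_eq_0[of x i N ?a] that a1[of i] Suc.prems(2) by simp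
    have "Suc m \<le> ?a j" for j using Suc.prems(3)[of j] by auto
    then have "Ck m (\<lambda>x. ?w ?a T' x * ?ch x)" using T' Suc by blast
    moreover have "((\<lambda>t. ?w a T (x + t *\<^sub>R axis i 1) * ?ch (x + t *\<^sub>R axis i 1))
           has_real_derivative ?w ?a T' x * ?ch x) (at 0)" for x
      using has_real_derivative_cutoff_cbox[OF T'(2) Suc.prems(2)] z by blast
    ultimately show ?thesis by (intro exI conjI allI)
  qed
  ultimately show ?case by simp
qed

subsection \<open>The space of square-integrable functions\<close>

lemma L2_measurable: "f \<in> L2 \<Longrightarrow> f \<in> borel_measurable lebesgue"
  and L2_integrable: "f \<in> L2 \<Longrightarrow> integrable lebesgue (\<lambda>x. (norm (f x))\<^sup>2)"
  by (auto simp: L2_def)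

lemma L2_I_bound:
  assumes "f \<in> borel_measurable lebesgue" "integrable lebesgue b" "\<And>x. (norm (f x))\<^sup>2 \<le> b x"
  shows "f \<in> L2"
proof -
  have "AE x in lebesgue. norm ((norm (f x))\<^sup>2) \<le> norm (b x)"
    using assms(3) abs_ge_self order_trans by (intro AE_I2) fastforce
  then show ?thesis
    unfolding L2_def using assms(1) by (auto intro!: Bochner_Integration.integrable_bound[OF assms(2)])
qed

lemma L2_add: 
  assumes "f \<in> L2" "g \<in> L2"
  shows "(\<lambda>x. f x + g x) \<in> L2"
proof (rule L2_I_bound)
  show "integrable lebesgue (\<lambda>x. 2 * (norm (f x))\<^sup>2 + 2 * (norm (g x))\<^sup>2)"
    using assms by (simp add: L2_integrable)
  fix x
  have "(norm (f x + g x))\<^sup>2 \<le> (norm (f x) + norm (g x))\<^sup>2"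
    by (simp add: norm_triangle_ineq)
  also have "\<dots> \<le> 2 * (norm (f x))\<^sup>2 + 2 * (norm (g x))\<^sup>2"
    using sum_squares_bound[of "norm (f x)" "norm (g x)"] by (simp add: power2_sum)
  finally show "(norm (f x + g x))\<^sup>2 \<le> 2 * (norm (f x))\<^sup>2 + 2 * (norm (g x))\<^sup>2" .
qed (intro borel_measurable_add L2_measurable assms)

lemma L2_mult_bounded:
  assumes "f \<in> L2" "g \<in> borel_measurable lebesgue" "\<And>x. norm (g x) \<le> C"
  shows "(\<lambda>x. g x * f x) \<in> L2"
proof (rule L2_I_bound)
  show "integrable lebesgue (\<lambda>x. C\<^sup>2 * (norm (f x))\<^sup>2)"
    using assms by (simp add: L2_integrable)
  show "(norm (g x * f x))\<^sup>2 \<le> C\<^sup>2 * (norm (f x))\<^sup>2" for x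
    unfolding norm_mult power_mult_distrib
    by (intro mult_right_mono power_mono assms) auto
qed (intro borel_measurable_times L2_measurable assms)

lemma L2_scale: "f \<in> L2 \<Longrightarrow> (\<lambda>x. c * f x) \<in> L2"
  by (rule L2_mult_bounded[of _ "\<lambda>_. c" "norm c"]) auto

lemma L2_uminus: "f \<in> L2 \<Longrightarrow> (\<lambda>x. - f x) \<in> L2"
  using L2_scale[of f "-1"] by simp

lemma L2_diff: "f \<in> L2 \<Longrightarrow> g \<in> L2 \<Longrightarrow> (\<lambda>x. f x - g x) \<in> L2"
  using L2_add[of f "\<lambda>x. - g x"] L2_uminus by auto

lemma L2_zero: "(\<lambda>x. 0) \<in> L2"
  by (simp add: L2_def)

lemma L2_sum: "(\<And>i. i \<in> S \<Longrightarrow> f i \<in> L2) \<Longrightarrow> (\<lambda>x. \<Sum>i\<in>S. f i x) \<in> L2"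
  by (induction S rule: infinite_finite_induct) (auto intro: L2_add L2_zero)

lemma L2_mult_integrable:
  assumes "f \<in> L2" "g \<in> L2"
  shows "integrable lebesgue (\<lambda>x. f x * cnj (g x))"
proof (rule Bochner_Integration.integrable_bound)
  show "integrable lebesgue (\<lambda>x. (norm (f x))\<^sup>2 + (norm (g x))\<^sup>2)"
    using assms by (simp add: L2_integrable)
  have "norm (f x) * norm (g x) \<le> (norm (f x))\<^sup>2 + (norm (g x))\<^sup>2" for x
    using sum_squares_bound[of "norm (f x)" "norm (g x)"] mult_nonneg_nonneg[OF norm_ge_zero[of "f x"] norm_ge_zero[of "g x"]]
    unfolding mult.assoc by linarith
  then show "AE x in lebesgue. norm (f x * cnj (g x)) \<le> norm ((norm (f x))\<^sup>2 + (norm (g x))\<^sup>2)"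
    by (auto simp: norm_mult)
  show "(\<lambda>x. f x * cnj (g x)) \<in> borel_measurable lebesgue"
    using assms by (intro borel_measurable_times measurable_compose[OF L2_measurable borel_measurable_continuous_onI[where f = cnj]])
      (auto intro!: continuous_intros L2_measurable)
qed

lemma L2_inner_diff_left: "f \<in> L2 \<Longrightarrow> g \<in> L2 \<Longrightarrow> u \<in> L2 \<Longrightarrow>
    L2_inner (\<lambda>x. f x - g x) u = L2_inner f u - L2_inner g u"
  by (simp add: L2_inner_def left_diff_distrib L2_mult_integrable)

lemma L2_inner_diff_right: "f \<in> L2 \<Longrightarrow> g \<in> L2 \<Longrightarrow> u \<in> L2 \<Longrightarrow>
    L2_inner u (\<lambda>x. f x - g x) = L2_inner u f - L2_inner u g"
  by (simp add: L2_inner_def right_diff_distrib L2_mult_integrable)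

lemma L2_inner_scale_left: "L2_inner (\<lambda>x. c * f x) u = c * L2_inner f u"
  by (simp add: L2_inner_def mult.assoc)

lemma L2_inner_cnj: "cnj (L2_inner f g) = L2_inner g f"
  unfolding L2_inner_def by (subst Bochner_Integration.integral_cnj[symmetric]) (simp add: mult.commute)

lemma L2_inner_sum_left: "(\<And>i. i \<in> S \<Longrightarrow> f i \<in> L2) \<Longrightarrow> u \<in> L2 \<Longrightarrow>
    L2_inner (\<lambda>x. \<Sum>i\<in>S. f i x) u = (\<Sum>i\<in>S. L2_inner (f i) u)"
  by (simp add: L2_inner_def sum_distrib_right L2_mult_integrable)

lemma L2_norm_nonneg: "L2_norm f \<ge> 0"
  by (simp add: L2_norm_def)

lemma L2_norm_power2: "(L2_norm f)\<^sup>2 = (LINT x|lebesgue. (norm (f x))\<^sup>2)"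
  by (simp add: L2_norm_def)

lemma L2_inner_self: "L2_inner f f = complex_of_real ((L2_norm f)\<^sup>2)"
  unfolding L2_norm_power2 L2_inner_def
  by (simp add: complex_norm_square[symmetric] flip: integral_complex_of_real)

lemma L2_norm_uminus: "L2_norm (\<lambda>x. - f x) = L2_norm f"
  by (simp add: L2_norm_def)

lemma L2_norm_power2_diff:
  assumes "f \<in> L2" "g \<in> L2"
  shows "(L2_norm (\<lambda>x. f x - g x))\<^sup>2 = (L2_norm f)\<^sup>2 - 2 * Re (L2_inner f g) + (L2_norm g)\<^sup>2"
proof -
  have d: "(\<lambda>x. f x - g x) \<in> L2" using assms by (rule L2_diff)
  have "complex_of_real ((L2_norm (\<lambda>x. f x - g x))\<^sup>2) = L2_inner (\<lambda>x. f x - g x) (\<lambda>x. f x - g x)"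
    by (simp only: L2_inner_self)
  also have "\<dots> = L2_inner f f - L2_inner g f - (L2_inner f g - L2_inner g g)"
    using assms d by (simp add: L2_inner_diff_left L2_inner_diff_right)
  also have "\<dots> = complex_of_real ((L2_norm f)\<^sup>2 - 2 * Re (L2_inner f g) + (L2_norm g)\<^sup>2)"
    unfolding L2_inner_cnj[of f g, symmetric] by (simp add: L2_inner_self complex_eq_iff)
  finally show ?thesis using of_real_eq_iff by blast
qed

text \<open>Nonnegativity of the squared norm of \<open>f - t <f, g> g\<close> gives an inequality
  quadratic in \<open>t\<close>, best at \<open>t = 1 / ||g||^2\<close>. If \<open>||g|| = 0\<close>
  the quadratic term is absent, and a large \<open>t\<close> forces
  \<open><f, g> = 0\<close>.\<close>

lemma L2_cauchy_schwarz:
  assumes "f \<in> L2" "g \<in> L2"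
  shows "norm (L2_inner f g) \<le> L2_norm f * L2_norm g"
proof -
  let ?i = "L2_inner f g"
  have key: "2 * (norm ?i)\<^sup>2 * t \<le> (L2_norm f)\<^sup>2 + t\<^sup>2 * (norm ?i)\<^sup>2 * (L2_norm g)\<^sup>2" for t :: real
  proof -
    let ?c = "complex_of_real t * ?i"
    have "0 \<le> (L2_norm (\<lambda>x. f x - ?c * g x))\<^sup>2" by simp
    also have "\<dots> = (L2_norm f)\<^sup>2 - 2 * Re (L2_inner f (\<lambda>x. ?c * g x)) + (L2_norm (\<lambda>x. ?c * g x))\<^sup>2"
      using assms by (intro L2_norm_power2_diff L2_scale)
    also have "L2_inner f (\<lambda>x. ?c * g x) = cnj ?c * ?i"
      by (subst L2_inner_cnj[symmetric], subst L2_inner_scale_left) (simp add: L2_inner_cnj)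
    also have "\<dots> = complex_of_real (t * (norm ?i)\<^sup>2)"
      unfolding of_real_mult complex_norm_square by simp
    also have "(L2_norm (\<lambda>x. ?c * g x))\<^sup>2 = t\<^sup>2 * (norm ?i)\<^sup>2 * (L2_norm g)\<^sup>2"
      by (simp add: L2_norm_power2 norm_mult power_mult_distrib)
    finally show ?thesis by (simp add: mult_ac)
  qed
  show ?thesis
  proof (cases "L2_norm g = 0")
    case True
    have "?i = 0"
    proof (rule ccontr)
      assume "?i \<noteq> 0"
      then show False
        using key[of "((L2_norm f)\<^sup>2 + 1) / (norm ?i)\<^sup>2"] True
          zero_le_power2[of "L2_norm f"] by (simp del: zero_le_power2)
    qed
    then show ?thesis by (simp add: L2_norm_nonneg)
  next
    case False
    then have pos: "(L2_norm g)\<^sup>2 > 0" by simp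
    have "2 * (norm ?i)\<^sup>2 / (L2_norm g)\<^sup>2 \<le> (L2_norm f)\<^sup>2 + (norm ?i)\<^sup>2 / (L2_norm g)\<^sup>2"
      using key[of "1 / (L2_norm g)\<^sup>2"] False by (simp add: field_simps power2_eq_square)
    then have "(norm ?i)\<^sup>2 \<le> (L2_norm f * L2_norm g)\<^sup>2"
      using pos by (simp add: field_simps power_mult_distrib)
    then show ?thesis by (rule power2_le_imp_le) (simp add: L2_norm_nonneg)
  qed
qed

lemma L2_norm_triangle:
  assumes "f \<in> L2" "g \<in> L2"
  shows "L2_norm (\<lambda>x. f x + g x) \<le> L2_norm f + L2_norm g"
proof (rule power2_le_imp_le)
  have "(L2_norm (\<lambda>x. f x + g x))\<^sup>2 = (L2_norm f)\<^sup>2 - 2 * Re (L2_inner f (\<lambda>x. - g x)) + (L2_norm g)\<^sup>2"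
    using L2_norm_power2_diff[OF assms(1) L2_uminus[OF assms(2)]] by (simp add: L2_norm_uminus)
  moreover have "\<bar>Re (L2_inner f (\<lambda>x. - g x))\<bar> \<le> L2_norm f * L2_norm g"
    using order_trans[OF abs_Re_le_cmod L2_cauchy_schwarz[OF assms(1) L2_uminus[OF assms(2)]]]
    by (simp add: L2_norm_uminus)
  ultimately show "(L2_norm (\<lambda>x. f x + g x))\<^sup>2 \<le> (L2_norm f + L2_norm g)\<^sup>2"
    by (simp add: power2_sum)
qed (simp add: L2_norm_nonneg add_nonneg_nonneg)

lemma L2_norm_triangle_diff:
  assumes "f \<in> L2" "g \<in> L2" "u \<in> L2"
  shows "L2_norm (\<lambda>x. f x - u x) \<le> L2_norm (\<lambda>x. f x - g x) + L2_norm (\<lambda>x. g x - u x)"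
  using L2_norm_triangle[OF L2_diff[OF assms(1,2)] L2_diff[OF assms(2,3)]] by simp

lemma L2_norm_tendsto_0:
  fixes f :: "real^'a \<Rightarrow> complex"
  assumes f: "f \<in> borel_measurable lebesgue" "\<And>n. g n \<in> borel_measurable lebesgue"
    and b: "integrable lebesgue b" "\<And>n x. (norm (f x - g n x))\<^sup>2 \<le> b x"
    and lim: "AE x in lebesgue. (\<lambda>n. g n x) \<longlonglongrightarrow> f x"
  shows "(\<lambda>n. L2_norm (\<lambda>x. f x - g n x)) \<longlonglongrightarrow> 0"
proof -
  have "(\<lambda>n. LINT x|lebesgue. (norm (f x - g n x))\<^sup>2) \<longlonglongrightarrow> (LINT x::real^'a|lebesgue. 0)"
  proof (rule integral_dominated_convergence[where w = b])
    show "AE x in lebesgue. (\<lambda>n. (norm (f x - g n x))\<^sup>2) \<longlonglongrightarrow> 0"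
      using lim
    proof eventually_elim
      case (elim x)
      have "(\<lambda>n. (norm (f x - g n x))\<^sup>2) \<longlonglongrightarrow> (norm (f x - f x))\<^sup>2"
        by (intro tendsto_intros elim)
      then show ?case by simp
    qed
  qed (use f b in \<open>auto intro!: borel_measurable_power borel_measurable_norm borel_measurable_diff\<close>)
  then have "(\<lambda>n. sqrt (LINT x|lebesgue. (norm (f x - g n x))\<^sup>2)) \<longlonglongrightarrow> sqrt 0"
    by (intro tendsto_real_sqrt) simp
  then show ?thesis by (simp add: L2_norm_def)
qed

subsection \<open>Linear changes of variables\<close>

lemma matrix_inv:
  assumes "invertible A"
  shows "A ** matrix_inv A = mat 1" "matrix_inv A ** A = mat 1"
  using assms someI_ex[of "\<lambda>B. A ** B = mat 1 \<and> B ** A = mat 1"]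
  unfolding invertible_def matrix_inv_def by blast+

text \<open>The shear is linear, so translating the box by \<open>v\<close> translates its image by
  the sheared \<open>v\<close>. The shift moves the n-th lower bound to \<open>0\<close>, the
  position in which \<open>measure_shear_interval\<close> applies.\<close>

lemma measure_shear_cbox:
  fixes a b :: "real^'n"
  assumes "m \<noteq> n"
  shows "measure lebesgue ((\<lambda>x. \<chi> i. if i = m then x$m + x$n else x$i) ` cbox a b)
    = measure lebesgue (cbox a b)"
proof (cases "cbox a b = {}")
  case False
  let ?h = "\<lambda>x::real^'n. \<chi> i. if i = m then x$m + x$n else x$i"
  let ?v = "axis n (- a $ n) :: real^'n"
  have "?h ` (+) ?v ` cbox a b = (+) (?h ?v) ` ?h ` cbox a b"
    unfolding image_image by (rule image_cong) (auto simp: vec_eq_iff)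
  then have "measure lebesgue (?h ` cbox a b) = measure lebesgue (?h ` cbox (?v + a) (?v + b))"
    using measure_translation[of "?h ?v" "?h ` cbox a b"] by (simp add: cbox_translation)
  also have "\<dots> = measure lebesgue (cbox (?v + a) (?v + b))"
  proof (rule measure_shear_interval[OF assms])
    show "cbox (?v + a) (?v + b) \<noteq> {}" using False cbox_translation[of ?v a b] by auto
  qed simp
  also have "\<dots> = measure lebesgue (cbox a b)"
    using measure_translation[of ?v "cbox a b"] cbox_translation[of ?v a b] by metis
  finally show ?thesis .
qed simp

lemma measure_swap_cbox:
  fixes a b :: "real^'n"
  shows "measure lebesgue ((\<lambda>x. \<chi> i. x $ Transposition.transpose m n i) ` cbox a b)
    = measure lebesgue (cbox a b)"
proof (cases "cbox a b = {}")
  case False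
  let ?p = "Transposition.transpose m n"
  let ?h = "\<lambda>x::real^'n. \<chi> i. x $ ?p i"
  have eq: "?h ` cbox a b = cbox (?h a) (?h b)"
  proof (intro equalityI subsetI)
    fix y assume "y \<in> cbox (?h a) (?h b)"
    then have "?h y \<in> cbox a b"
      unfolding mem_box_cart by (metis transpose_involutory vec_lambda_beta)
    moreover have "y = ?h (?h y)" by (simp add: vec_eq_iff)
    ultimately show "y \<in> ?h ` cbox a b" by blast
  qed (auto simp: mem_box_cart)
  then have "cbox (?h a) (?h b) \<noteq> {}" using False by blast
  with False show ?thesis
    unfolding eq using prod.permute[OF permutes_swap_id[of m UNIV n], of "\<lambda>i. (b - a) $ i"]
    by (simp add: content_cbox_cart o_def)
qed simp

text \<open>The library states this only for well-ordered index types, because it computes the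
  determinant of a shear from its triangular form.\<close>

lemma measure_matrix_image:
  fixes A :: "real^'n^'n"
  assumes "S \<in> lmeasurable"
  shows "(*v) A ` S \<in> lmeasurable \<and> measure lebesgue ((*v) A ` S) = \<bar>det A\<bar> * measure lebesgue S"
proof -
  define P where "P A \<longleftrightarrow> (\<forall>S\<in>lmeasurable. (*v) A ` S \<in> lmeasurable \<and>
      measure lebesgue ((*v) A ` S) = \<bar>det A\<bar> * measure lebesgue S)" for A :: "real^'n^'n"
  \<comment> \<open>Swaps and shears have determinant of modulus 1, and for linear maps the scaling
    factor need only be checked on boxes.\<close>
  have P_det_1: "P A" if "\<bar>det A\<bar> = 1" "(*v) A = f"
    "\<And>a b. measure lebesgue (f ` cbox a b) = measure lebesgue (cbox a b)" for A f
  proof -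
    have "measure lebesgue ((*v) A ` cbox a b) = 1 * measure lebesgue (cbox a b)" for a b
      using that(2,3) by simp
    then show ?thesis
      unfolding P_def that(1)
      using measure_linear_sufficient[OF matrix_vector_mul_linear[of A], of _ 1] by metis
  qed
  have "P A"
  proof (rule induct_matrix_elementary_alt)
    fix A B :: "real^'n^'n" assume AB: "P A" "P B"
    have "(*v) (A ** B) ` S = (*v) A ` (*v) B ` S" for S
      by (simp add: image_image matrix_vector_mul_assoc)
    then show "P (A ** B)" using AB unfolding P_def by (auto simp: det_mul abs_mult)
  next
    fix A :: "real^'n^'n" and i assume "row i A = 0"
    then have "det A = 0" by (metis det_zero_row(1) )
    then have "\<not> inj ((*v) A)"
      using det_nz_iff_inj[OF matrix_vector_mul_linear[of A]] by (simp add: matrix_of_matrix_vector_mul)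
    then have "negligible ((*v) A ` S)" for S
      by (meson matrix_vector_mul_linear negligible_linear_singular_image)
    then show "P A" unfolding P_def using \<open>det A = 0\<close>
      by (simp add: negligible_imp_measurable negligible_imp_measure0)
  next
    fix A :: "real^'n^'n" assume A: "\<And>i j. i \<noteq> j \<Longrightarrow> A $ i $ j = 0"
    have "(*v) A = (\<lambda>x. \<chi> k. A $ k $ k * x $ k)"
    proof (intro ext, unfold vec_eq_iff, intro allI, unfold vec_lambda_beta)
      fix x k
      have "(A *v x) $ k = (\<Sum>j\<in>UNIV. if j = k then A $ k $ k * x $ k else 0)"
        unfolding matrix_vector_mult_def vec_lambda_beta by (rule sum.cong) (auto simp: A)
      also have "\<dots> = A $ k $ k * x $ k" by simp
      finally show "(A *v x) $ k = A $ k $ k * x $ k" .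
    qed
    then show "P A" unfolding P_def
      by (simp add: measurable_stretch measure_stretch det_diagonal A)
  next
    fix m n :: 'n assume "m \<noteq> n"
    show "P (\<chi> i j. mat 1 $ i $ Transposition.transpose m n j)"
    proof (rule P_det_1[OF _ _ measure_swap_cbox[of m n]])
      show "(*v) (\<chi> i j. mat 1 $ i $ Transposition.transpose m n j) =
          (\<lambda>x::real^'n. \<chi> i. x $ Transposition.transpose m n i)"
      proof (intro ext, unfold vec_eq_iff, intro allI, unfold vec_lambda_beta)
        fix x :: "real^'n" and k
        have "((\<chi> i j. mat 1 $ i $ Transposition.transpose m n j) *v x) $ k
          = (\<Sum>j\<in>UNIV. if j = Transposition.transpose m n k then x $ j else 0)"
          unfolding matrix_vector_mult_def vec_lambda_beta by (rule sum.cong) (auto simp: mat_def)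
        also have "\<dots> = x $ Transposition.transpose m n k" by simp
        finally show "((\<chi> i j. mat 1 $ i $ Transposition.transpose m n j) *v x) $ k
            = x $ Transposition.transpose m n k" .
      qed
      show "\<bar>det ((\<chi> i j. mat 1 $ i $ Transposition.transpose m n j) :: real^'n^'n)\<bar> = 1"
        by (simp add: det_permute_columns permutes_swap_id sign_swap_id abs_mult)
    qed
  next
    fix m n :: 'n assume mn: "m \<noteq> n"
    let ?E = "(\<chi> i j. of_bool (i = m \<and> j = n \<or> i = j)) :: real^'n^'n"
    show "P ?E"
    proof (rule P_det_1[OF _ _ measure_shear_cbox[OF mn]])
      have "?E = (\<chi> k. if k = m then row m (mat 1) + 1 *s row n (mat 1) else row k (mat 1))"
        using mn by (auto simp: vec_eq_iff row_def mat_def)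
      then have "det ?E = det (mat 1 :: real^'n^'n)"
        using det_row_operation[OF mn, of "mat 1 :: real^'n^'n" 1] by (simp only:)
      then show "\<bar>det ?E\<bar> = 1" by simp
      show "(*v) ?E = (\<lambda>x. \<chi> i. if i = m then x$m + x$n else x$i)"
      proof (intro ext, unfold vec_eq_iff, intro allI, unfold vec_lambda_beta)
        fix x :: "real^'n" and k
        have "(?E *v x) $ k
          = (\<Sum>j\<in>UNIV. (if j = k then x $ j else 0) + (if j = n then (if k = m then x $ j else 0) else 0))"
          unfolding matrix_vector_mult_def vec_lambda_beta using mn by (intro sum.cong) auto
        also have "\<dots> = (if k = m then x$m + x$n else x$k)"
          by (subst sum.distrib) simp
        finally show "(?E *v x) $ k = (if k = m then x$m + x$n else x$k)" .
      qed
    qed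
  qed
  then show ?thesis using assms unfolding P_def by blast
qed

text \<open>Lebesgue measure is determined by its values on boxes. The preimage of a box under
  \<open>A\<close> is its image under the inverse matrix, whose determinant the density
  cancels.\<close>

lemma lborel_matrix_image:
  fixes A :: "real^'n^'n"
  assumes "invertible A"
  shows "lborel = density (distr lborel borel ((*v) A)) (\<lambda>_. ennreal \<bar>det A\<bar>)"
proof (rule lborel_eqI)
  let ?A' = "matrix_inv A"
  have meas[measurable]: "(*v) A \<in> borel_measurable borel"
    by (simp add: borel_measurable_continuous_onI linear_continuous_on)
  have dets: "\<bar>det A\<bar> * \<bar>det ?A'\<bar> = 1"
    by (metis abs_mult abs_one assms det_I det_mul matrix_inv(1))
  fix l u :: "real^'n" assume le: "\<And>b. b \<in> Basis \<Longrightarrow> l \<bullet> b \<le> u \<bullet> b"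
  have "(*v) A -` box l u = (*v) ?A' ` box l u"
  proof (intro equalityI subsetI)
    fix x assume "x \<in> (*v) A -` box l u"
    moreover have "x = ?A' *v (A *v x)"
      by (metis assms matrix_inv(2) matrix_vector_mul_assoc matrix_vector_mul_lid)
    ultimately show "x \<in> (*v) ?A' ` box l u" by blast
  next
    fix x assume "x \<in> (*v) ?A' ` box l u"
    then show "x \<in> (*v) A -` box l u"
      using assms by (auto simp: matrix_vector_mul_assoc matrix_inv)
  qed
  then have img: "(*v) A -` box l u \<in> lmeasurable"
      "measure lebesgue ((*v) A -` box l u) = \<bar>det ?A'\<bar> * measure lebesgue (box l u)"
    using measure_matrix_image[OF lmeasurable_box, of ?A'] by auto
  have "(*v) A -` box l u \<in> sets borel"
    using measurable_sets[OF meas, of "box l u"] by simp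
  then have "emeasure lborel ((*v) A -` box l u) = emeasure lebesgue ((*v) A -` box l u)"
    by simp
  also have "\<dots> = ennreal (\<bar>det ?A'\<bar> * measure lebesgue (box l u))"
    using img fmeasurableD2[OF img(1)] by (simp add: emeasure_eq_ennreal_measure)
  finally have pre: "emeasure lborel ((*v) A -` box l u) = ennreal (\<bar>det ?A'\<bar> * measure lebesgue (box l u))" .
  have "emeasure (density (distr lborel borel ((*v) A)) (\<lambda>_. ennreal \<bar>det A\<bar>)) (box l u)
      = ennreal \<bar>det A\<bar> * emeasure (distr lborel borel ((*v) A)) (box l u)"
    by (simp add: emeasure_density nn_integral_cmult)
  also have "\<dots> = ennreal \<bar>det A\<bar> * ennreal (\<bar>det ?A'\<bar> * measure lebesgue (box l u))"
    using pre by (simp add: emeasure_distr)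
  also have "\<dots> = ennreal (\<bar>det A\<bar> * \<bar>det ?A'\<bar> * measure lebesgue (box l u))"
    by (simp add: ennreal_mult' mult.assoc)
  also have "\<dots> = ennreal (measure lebesgue (box l u))" using dets by simp
  also have "measure lebesgue (box l u) = (\<Prod>b\<in>Basis. (u - l) \<bullet> b)"
    using le by (simp add: measure_lborel_box_eq)
  finally show "emeasure (density (distr lborel borel ((*v) A)) (\<lambda>_. ennreal \<bar>det A\<bar>)) (box l u)
      = (\<Prod>b\<in>Basis. (u - l) \<bullet> b)" .
qed simp

text \<open>The passage from Borel to Lebesgue measurable sets rests on matching null sets: since
  \<open>det A \<noteq> 0\<close>, a Borel set is null exactly if its preimage under
  \<open>A\<close> is null.\<close>

lemma
  fixes A :: "real^'n^'n"
  assumes "invertible A"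
  shows lebesgue_matrix_image: "lebesgue = density (distr lebesgue lebesgue ((*v) A)) (\<lambda>_. ennreal \<bar>det A\<bar>)"
    and lebesgue_matrix_measurable: "(*v) A \<in> lebesgue \<rightarrow>\<^sub>M lebesgue"
proof -
  let ?T = "(*v) A"
  have T[measurable]: "?T \<in> borel \<rightarrow>\<^sub>M borel"
    by (simp add: borel_measurable_continuous_onI linear_continuous_on)
  have d: "\<bar>det A\<bar> > 0" using assms invertible_det_nz by auto
  have "emeasure lborel S = 0 \<longleftrightarrow> emeasure (distr lebesgue lborel ?T) S = 0" if "S \<in> sets borel" for S
  proof -
    have "emeasure lborel S = \<bar>det A\<bar> * emeasure (distr lborel borel ?T) S"
      using that by (subst lborel_matrix_image[OF assms]) (simp add: emeasure_density nn_integral_cmult)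
    then show ?thesis using d
      by (simp add: distr_completion cong: distr_cong)
  qed
  then have null: "null_sets lborel = null_sets (distr lebesgue lborel ?T)"
    by (auto simp: null_sets_def)
  show "?T \<in> lebesgue \<rightarrow>\<^sub>M lebesgue"
    by (simp add: completion.measurable_completion2 null measurable_completion)
  have "lebesgue = completion (density (distr lborel borel ?T) (\<lambda>_. ennreal \<bar>det A\<bar>))"
    by (subst lborel_matrix_image[OF assms]) simp
  also have "\<dots> = density (completion (distr lebesgue lborel ?T)) (\<lambda>_. ennreal \<bar>det A\<bar>)"
    using d by (auto intro!: completion_density_eq simp: distr_completion cong: distr_cong)
  also have "completion (distr lebesgue lborel ?T) = distr lebesgue lebesgue ?T"
    by (subst completion.completion_distr_eq) (auto simp: null measurable_completion)
  finally show "lebesgue = density (distr lebesgue lebesgue ?T) (\<lambda>_. ennreal \<bar>det A\<bar>)" .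
qed

lemma borel_measurable_matrix:
  fixes A :: "real^'n^'n"
  assumes "invertible A" "f \<in> borel_measurable lebesgue"
  shows "(\<lambda>x. f (A *v x)) \<in> borel_measurable lebesgue"
  using measurable_compose[OF lebesgue_matrix_measurable[OF assms(1)] assms(2)] .

lemma
  fixes A :: "real^'n^'n" and f :: "real^'n \<Rightarrow> 'b::{banach, second_countable_topology}"
  assumes A: "invertible A" and f: "f \<in> borel_measurable lebesgue"
  shows integrable_matrix_iff: "integrable lebesgue f \<longleftrightarrow> integrable lebesgue (\<lambda>x. f (A *v x))"
    and integral_matrix: "(LINT x|lebesgue. f x) = \<bar>det A\<bar> *\<^sub>R (LINT x|lebesgue. f (A *v x))"
proof -
  let ?D = "distr lebesgue lebesgue ((*v) A)"
  note [measurable] = lebesgue_matrix_measurable[OF A]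
  have d: "\<bar>det A\<bar> \<noteq> 0" using A invertible_det_nz by auto
  have f': "f \<in> borel_measurable ?D" using f by simp
  have "integrable lebesgue f \<longleftrightarrow> integrable ?D (\<lambda>x. \<bar>det A\<bar> *\<^sub>R f x)"
    by (subst lebesgue_matrix_image[OF A], subst integrable_density) (auto simp: f' f)
  also have "\<dots> \<longleftrightarrow> integrable lebesgue (\<lambda>x. \<bar>det A\<bar> *\<^sub>R f (A *v x))"
    using f by (subst integrable_distr_eq) auto
  finally show "integrable lebesgue f \<longleftrightarrow> integrable lebesgue (\<lambda>x. f (A *v x))"
    using d integrable_scaleR_right[of "inverse \<bar>det A\<bar>" lebesgue "\<lambda>x. \<bar>det A\<bar> *\<^sub>R f (A *v x)"]
    by (auto simp del: integrable_scaleR_right simp: integrable_scaleR_right)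
  have "(LINT x|lebesgue. f x) = (LINT x|?D. \<bar>det A\<bar> *\<^sub>R f x)"
    by (subst lebesgue_matrix_image[OF A], subst integral_density) (auto simp: f' f)
  also have "\<dots> = (LINT x|lebesgue. \<bar>det A\<bar> *\<^sub>R f (A *v x))"
    using f by (subst integral_distr) auto
  finally show "(LINT x|lebesgue. f x) = \<bar>det A\<bar> *\<^sub>R (LINT x|lebesgue. f (A *v x))"
    by simp
qed

lemma
  fixes t :: "'a::euclidean_space"
  shows lebesgue_distr_translation: "distr lebesgue lebesgue (\<lambda>x. t + x) = lebesgue"
    and lebesgue_translation_measurable: "(\<lambda>x. t + x) \<in> lebesgue \<rightarrow>\<^sub>M lebesgue"
  using lebesgue_affine_euclidean[of "\<lambda>_. 1" t] lebesgue_affine_measurable[of "\<lambda>_. 1" t]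
  by (simp_all add: euclidean_representation density_1)

lemma
  fixes t :: "'a::euclidean_space" and f :: "'a \<Rightarrow> 'b::{banach, second_countable_topology}"
  assumes f: "f \<in> borel_measurable lebesgue"
  shows borel_measurable_translation: "(\<lambda>x. f (t + x)) \<in> borel_measurable lebesgue"
    and integrable_translation_iff: "integrable lebesgue f \<longleftrightarrow> integrable lebesgue (\<lambda>x. f (t + x))"
    and integral_translation: "(LINT x|lebesgue. f x) = (LINT x|lebesgue. f (t + x))"
proof -
  note [measurable] = lebesgue_translation_measurable[of t]
  show "(\<lambda>x. f (t + x)) \<in> borel_measurable lebesgue" using f by measurable
  show "integrable lebesgue f \<longleftrightarrow> integrable lebesgue (\<lambda>x. f (t + x))"
    using f by (subst lebesgue_distr_translation[symmetric, of t], subst integrable_distr_eq) auto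
  show "(LINT x|lebesgue. f x) = (LINT x|lebesgue. f (t + x))"
    using f by (subst lebesgue_distr_translation[symmetric, of t], subst integral_distr) auto
qed

subsection \<open>Characters and the unit cube\<close>

definition echar :: "real^'d \<Rightarrow> real^'d \<Rightarrow> complex" where
  "echar k x = exp (2 * pi * \<i> * complex_of_real (k \<bullet> x))"

text \<open>Half-open, so that the integer translates partition the space and
  \<open>vfloor x\<close> names the one containing \<open>x\<close>.\<close>

definition ucube :: "(real^'d) set" where
  "ucube = {x. \<forall>j. 0 \<le> x $ j \<and> x $ j < 1}"

definition vfloor :: "real^'d \<Rightarrow> real^'d" where
  "vfloor x = (\<chi> j. of_int \<lfloor>x $ j\<rfloor>)"

lemma Zvec_0: "0 \<in> Zvec"
  and Zvec_add: "k \<in> Zvec \<Longrightarrow> l \<in> Zvec \<Longrightarrow> k + l \<in> Zvec"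
  and Zvec_diff: "k \<in> Zvec \<Longrightarrow> l \<in> Zvec \<Longrightarrow> k - l \<in> Zvec"
  and Zvec_uminus: "k \<in> Zvec \<Longrightarrow> - k \<in> Zvec"
  and Zvec_axis: "axis j 1 \<in> Zvec"
  and vfloor_Zvec: "vfloor x \<in> Zvec"
  by (auto simp: Zvec_def vfloor_def axis_def)

lemma inner_Zvec: "k \<in> Zvec \<Longrightarrow> l \<in> Zvec \<Longrightarrow> k \<bullet> l \<in> \<int>"
  by (auto simp: Zvec_def inner_vec_def intro!: Ints_sum Ints_mult)

lemma finite_Zvec_bounded: "finite {k\<in>Zvec. \<forall>j. \<bar>k $ j\<bar> \<le> R}"
proof (rule finite_subset)
  let ?P = "PiE UNIV (\<lambda>_::'a. {- \<lceil>R\<rceil>..\<lceil>R\<rceil>})"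
  show "{k\<in>Zvec. \<forall>j. \<bar>k $ j\<bar> \<le> R} \<subseteq> (\<lambda>f. \<chi> j. of_int (f j)) ` ?P"
  proof
    fix k :: "real^'a" assume k: "k \<in> {k\<in>Zvec. \<forall>j. \<bar>k $ j\<bar> \<le> R}"
    then have "k $ j \<in> \<int>" for j by (auto simp: Zvec_def)
    then have fl: "of_int \<lfloor>k $ j\<rfloor> = k $ j" for j by (metis Ints_cases floor_of_int)
    have "\<lfloor>k $ j\<rfloor> \<in> {- \<lceil>R\<rceil>..\<lceil>R\<rceil>}" for j
    proof -
      have "\<bar>k $ j\<bar> \<le> R" using k by blast
      then have "k $ j \<le> R" "- R \<le> k $ j" by auto
      then show ?thesis by (simp add: floor_le_iff le_floor_iff) linarith
    qed
    then have "(\<lambda>j. \<lfloor>k $ j\<rfloor>) \<in> ?P" by auto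
    moreover have "k = (\<chi> j. of_int \<lfloor>k $ j\<rfloor>)" by (simp add: vec_eq_iff fl)
    ultimately show "k \<in> (\<lambda>f. \<chi> j. of_int (f j)) ` ?P"
      by (intro image_eqI[where x = "\<lambda>j. \<lfloor>k $ j\<rfloor>"])
  qed
qed (intro finite_imageI finite_PiE, auto)

lemma echar_add_left: "echar (k + l) x = echar k x * echar l x"
  and echar_add_right: "echar k (x + y) = echar k x * echar k y"
  and echar_0: "echar 0 x = 1"
  and cnj_echar: "cnj (echar k x) = echar (- k) x"
  by (simp_all add: echar_def inner_add_left inner_add_right distrib_left exp_add exp_cnj)

lemma norm_echar: "norm (echar k x) = 1"
  by (simp add: echar_def)

lemma echar_Ints: "k \<bullet> x \<in> \<int> \<Longrightarrow> echar k x = 1"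
  unfolding echar_def by (elim Ints_cases) (auto intro: exp_integer_2pi simp: mult_ac)

lemma echar_Zvec: "k \<in> Zvec \<Longrightarrow> l \<in> Zvec \<Longrightarrow> echar k l = 1"
  by (simp add: echar_Ints inner_Zvec)

lemma continuous_on_echar: "continuous_on S (echar k)"
  unfolding echar_def by (intro continuous_intros)

lemma borel_measurable_echar: "echar k \<in> borel_measurable lebesgue"
  using borel_measurable_continuous_onI[OF continuous_on_echar, of k] by (intro measurable_completion) simp

lemma mem_ucube_translate: 
  assumes "k \<in> Zvec"
  shows "x - k \<in> ucube \<longleftrightarrow> k = vfloor x"
proof -
  have "0 \<le> x $ j - k $ j \<and> x $ j - k $ j < 1 \<longleftrightarrow> k $ j = of_int \<lfloor>x $ j\<rfloor>" for j
  proof -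
    obtain n where n: "k $ j = of_int n" using assms by (auto simp: Zvec_def elim: Ints_cases)
    show ?thesis unfolding n of_int_eq_iff using floor_eq_iff[of "x $ j" n] by linarith
  qed
  then show ?thesis by (simp add: ucube_def vfloor_def vec_eq_iff)
qed

lemma ucube_sets: "ucube \<in> sets borel"
proof -
  have "ucube = (\<Inter>j. {x::real^'a. 0 \<le> x $ j} \<inter> {x. x $ j < 1})" by (auto simp: ucube_def)
  also have "\<dots> \<in> sets borel"
    by (intro sets.finite_INT borel_closed borel_open sets.Int closed_Collect_le open_Collect_less
        continuous_intros) auto
  finally show ?thesis .
qed

lemma ucube_subset: "box 0 1 \<subseteq> ucube" "ucube \<subseteq> cbox 0 1"
  by (auto simp: ucube_def mem_box_cart less_imp_le)

lemma ucube_lmeasurable: "ucube \<in> lmeasurable"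
proof (rule bounded_set_imp_lmeasurable)
  show "bounded (ucube :: (real^'a) set)" using ucube_subset(2) by (rule bounded_subset[OF bounded_cbox])
  show "(ucube :: (real^'a) set) \<in> sets lebesgue" by (simp add: ucube_sets sets_completionI_sets)
qed

lemma measure_ucube: "measure lebesgue (ucube :: (real^'d) set) = 1"
proof (rule antisym)
  have "(1::real^'d) \<bullet> b = 1" if "b \<in> Basis" for b
    using that by (auto simp: Basis_vec_def inner_axis)
  then have c: "measure lebesgue (cbox 0 1 :: (real^'d) set) = 1"
    "measure lebesgue (box 0 1 :: (real^'d) set) = 1"
    by (simp_all add: measure_lborel_box_eq measure_lborel_cbox_eq)
  show "measure lebesgue (ucube :: (real^'d) set) \<le> 1"
    using measure_mono_fmeasurable[OF ucube_subset(2) _ lmeasurable_cbox] c ucube_lmeasurable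
    by (metis fmeasurableD)
  show "1 \<le> measure lebesgue (ucube :: (real^'d) set)"
    using measure_mono_fmeasurable[OF ucube_subset(1) _ ucube_lmeasurable] c
    by (metis fmeasurableD lmeasurable_box)
qed

lemma borel_measurable_indicator_ucube: "indicator ucube \<in> borel_measurable lebesgue"
  using ucube_lmeasurable by (intro borel_measurable_indicator) (auto simp: fmeasurableD)

lemma integrable_indicator_ucube: "integrable lebesgue (indicator ucube :: _ \<Rightarrow> real)"
  using ucube_lmeasurable by (auto simp: fmeasurable_def intro!: integrable_real_indicator)

text \<open>Space is cut into the cells \<open>k + ucube\<close>, and each piece is translated back
  to the unit cube. The support of \<open>F\<close> meets only the finitely many cells in
  \<open>K\<close>, so no infinite sum is interchanged with the integral.\<close>

lemma integral_periodize:
  fixes F :: "real^'d \<Rightarrow> complex"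
  assumes F: "integrable lebesgue F" and K: "finite K" "K \<subseteq> Zvec"
    and supp: "\<And>x. F x \<noteq> 0 \<Longrightarrow> vfloor x \<in> K"
  shows "integrable lebesgue (\<lambda>y. (\<Sum>k\<in>K. F (k + y)) * indicator ucube y)"
    and "(LINT x|lebesgue. F x) = (LINT y|lebesgue. (\<Sum>k\<in>K. F (k + y)) * indicator ucube y)"
proof -
  have F': "F \<in> borel_measurable lebesgue" using F by auto
  have Fk: "integrable lebesgue (\<lambda>y. F (k + y))" for k
    using F integrable_translation_iff[OF F'] by blast
  have I: "integrable lebesgue (\<lambda>y. F (k + y) * indicator ucube y)" for k
  proof -
    have "(\<lambda>y. F (k + y) * indicator ucube y) = (\<lambda>y. indicator ucube y *\<^sub>R F (k + y))"
      by (auto simp: indicator_def fun_eq_iff)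
    then show ?thesis
      using integrable_mult_indicator[OF fmeasurableD[OF ucube_lmeasurable] Fk[of k]] by simp
  qed
  then show "integrable lebesgue (\<lambda>y. (\<Sum>k\<in>K. F (k + y)) * indicator ucube y)"
    by (simp add: sum_distrib_right)
  have 1: "(\<lambda>x. F x * indicator ucube (x - k)) \<in> borel_measurable lebesgue" for k
    using F' borel_measurable_translation[OF borel_measurable_indicator_ucube[where 'b=complex], of "- k"]
    by (intro borel_measurable_times) auto
  have 2: "integrable lebesgue (\<lambda>x. F x * indicator ucube (x - k))" for k
    using I[of k] integrable_translation_iff[OF 1, of k k] by simp
  have "F x = (\<Sum>k\<in>K. F x * indicator ucube (x - k))" for x
  proof -
    have "(\<Sum>k\<in>K. F x * indicator ucube (x - k)) = (\<Sum>k\<in>K. if k = vfloor x then F x else 0)"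
      using K(2) by (intro sum.cong) (auto simp: indicator_def mem_ucube_translate)
    also have "\<dots> = F x" using K supp[of x] by auto
    finally show ?thesis by simp
  qed
  then have "(LINT x|lebesgue. F x) = (LINT x|lebesgue. (\<Sum>k\<in>K. F x * indicator ucube (x - k)))"
    by simp
  also have "\<dots> = (\<Sum>k\<in>K. LINT x|lebesgue. F x * indicator ucube (x - k))"
    using 2 by simp
  also have "\<dots> = (\<Sum>k\<in>K. LINT y|lebesgue. F (k + y) * indicator ucube y)"
  proof (rule sum.cong)
    fix k show "(LINT x|lebesgue. F x * indicator ucube (x - k)) = (LINT y|lebesgue. F (k + y) * indicator ucube y)"
      using integral_translation[OF 1, of k k] by simp
  qed simp
  also have "\<dots> = (LINT y|lebesgue. (\<Sum>k\<in>K. F (k + y)) * indicator ucube y)"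
    using I by (simp add: sum_distrib_right)
  finally show "(LINT x|lebesgue. F x) = (LINT y|lebesgue. (\<Sum>k\<in>K. F (k + y)) * indicator ucube y)" .
qed

text \<open>The orthonormal system of Fourier series on the unit cube, placed inside
  \<open>L2\<close> of the whole space by extension with zero.\<close>

definition echar_cube :: "real^'d \<Rightarrow> real^'d \<Rightarrow> complex" where
  "echar_cube k x = echar k x * indicator ucube x"

lemma borel_measurable_echar_cube: "echar_cube k \<in> borel_measurable lebesgue"
  unfolding echar_cube_def
  by (intro borel_measurable_times borel_measurable_echar borel_measurable_indicator_ucube)

lemma integrable_echar_cube: "integrable lebesgue (echar_cube k)"
  by (rule Bochner_Integration.integrable_bound[OF integrable_indicator_ucube borel_measurable_echar_cube])
    (auto simp: echar_cube_def norm_mult norm_echar indicator_def)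

lemma echar_cube_L2: "echar_cube k \<in> L2"
  by (rule L2_I_bound[OF borel_measurable_echar_cube integrable_indicator_ucube])
    (auto simp: echar_cube_def norm_mult norm_echar indicator_def)

text \<open>For \<open>m \<noteq> 0\<close> the integral equals its own negative: shifting the cube
  by a vector \<open>t\<close> with \<open>echar m t = -1\<close> flips the sign, whereas
  periodising the shifted cube back into \<open>ucube\<close> leaves the integral unchanged.\<close>

lemma integral_echar_cube:
  assumes "m \<in> Zvec"
  shows "(LINT x|lebesgue. echar_cube m x) = (if m = 0 then 1 else 0)"
proof (cases "m = 0")
  case True
  have "(LINT x|lebesgue. indicator (ucube :: (real^'a) set) x :: complex) = complex_of_real (measure lebesgue (ucube :: (real^'a) set))"
  proof -
    have "(LINT x|lebesgue. indicator (ucube :: (real^'a) set) x :: complex) =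
        (LINT x|lebesgue. complex_of_real (indicator (ucube :: (real^'a) set) x))"
      by (intro Bochner_Integration.integral_cong) (auto simp: indicator_def)
    also have "\<dots> = complex_of_real (LINT x|lebesgue. indicator (ucube :: (real^'a) set) x)"
      by (rule integral_complex_of_real)
    finally show ?thesis by simp
  qed
  then show ?thesis by (simp add: True echar_cube_def echar_0 measure_ucube)
next
  case False
  then obtain j where j: "m $ j \<noteq> 0" by (auto simp: vec_eq_iff)
  then have "1 \<le> \<bar>m $ j\<bar>" using assms by (auto simp: Zvec_def Ints_nonzero_abs_ge1)
  \<comment> \<open>\<open>m \<bullet> t = 1/2\<close>, so the character takes the value
    \<open>-1\<close> at \<open>t\<close>; the shift stays below 1 because \<open>m $ j\<close> is a
    nonzero integer.\<close>
  define t :: "real^'a" where "t = axis j (1 / (2 * m $ j))"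
  have tb: "\<bar>t $ i\<bar> \<le> 1" for i
    using \<open>1 \<le> \<bar>m $ j\<bar>\<close> by (auto simp: t_def axis_def abs_mult field_simps)
  have et: "echar m t = -1" using j by (simp add: echar_def t_def inner_axis exp_eq_polar flip: cis_conv_exp)
  define F where "F = (\<lambda>x. echar m x * indicator ucube (x - t))"
  define K where "K = {k::real^'a\<in>Zvec. \<forall>j. \<bar>k $ j\<bar> \<le> 3}"
  have K: "finite K" "K \<subseteq> Zvec" by (auto simp: K_def finite_Zvec_bounded)
  have Ft: "F (t + x) = - echar_cube m x" for x
    by (simp add: F_def echar_cube_def echar_add_right et)
  have Fm: "F \<in> borel_measurable lebesgue"
    using borel_measurable_translation[OF borel_measurable_indicator_ucube[where 'b=complex], of "- t"]
    unfolding F_def by (intro borel_measurable_times borel_measurable_echar) auto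
  have Fi: "integrable lebesgue F"
    unfolding integrable_translation_iff[OF Fm, of t] Ft by (simp add: integrable_echar_cube)
  have vf: "vfloor x \<in> K" if "\<And>j. -1 \<le> x $ j \<and> x $ j \<le> 2" for x :: "real^'a"
  proof -
    have "\<bar>of_int \<lfloor>x $ j\<rfloor>\<bar> \<le> (3::real)" for j using that[of j] by linarith
    then show ?thesis using vfloor_Zvec[of x] by (simp add: K_def vfloor_def)
  qed
  have supp: "vfloor x \<in> K" if "F x \<noteq> 0" for x
  proof (rule vf)
    fix i
    have "x - t \<in> ucube" using that by (auto simp: F_def indicator_def split: if_splits)
    then have "0 \<le> x $ i - t $ i \<and> x $ i - t $ i < 1" by (simp add: ucube_def)
    then show "-1 \<le> x $ i \<and> x $ i \<le> 2" using tb[of i] by linarith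
  qed
  have "(\<Sum>k\<in>K. F (k + y)) * indicator ucube y = echar_cube m y" for y
  proof (cases "y \<in> ucube")
    case True
    have m: "- vfloor (y - t) \<in> K"
    proof -
      have "vfloor (y - t) \<in> K"
      proof (rule vf)
        fix i
        have "0 \<le> y $ i \<and> y $ i < 1" using True by (simp add: ucube_def)
        then show "-1 \<le> (y - t) $ i \<and> (y - t) $ i \<le> 2" using tb[of i] by simp linarith
      qed
      then show ?thesis by (auto simp: K_def intro: Zvec_uminus)
    qed
    \<comment> \<open>Exactly one integer translate of \<open>y\<close> lies in the shifted cube, so
      a single term survives.\<close>
    have "(\<Sum>k\<in>K. F (k + y)) = (\<Sum>k\<in>K. if k = - vfloor (y - t) then echar m y else 0)"
    proof (rule sum.cong)
      fix k assume "k \<in> K"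
      then have k: "k \<in> Zvec" using K by auto
      have "k + y - t \<in> ucube \<longleftrightarrow> - k = vfloor (y - t)"
        using mem_ucube_translate[of "- k" "y - t"] Zvec_uminus[OF k] by (simp add: algebra_simps)
      also have "\<dots> \<longleftrightarrow> k = - vfloor (y - t)" by (metis minus_minus)
      finally have "k + y - t \<in> ucube \<longleftrightarrow> k = - vfloor (y - t)" .
      then show "F (k + y) = (if k = - vfloor (y - t) then echar m y else 0)"
        using echar_Zvec[OF assms k] by (auto simp: F_def echar_add_right indicator_def)
    qed simp
    then show ?thesis using K m True by (simp add: echar_cube_def)
  qed (simp add: echar_cube_def)
  then have "(LINT x|lebesgue. F x) = (LINT x|lebesgue. echar_cube m x)"
    using integral_periodize(2)[OF Fi K supp] by simp
  moreover have "(LINT x|lebesgue. F x) = - (LINT x|lebesgue. echar_cube m x)"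
    unfolding integral_translation[OF Fm, of t] Ft by simp
  ultimately show ?thesis using False by simp
qed

lemma L2_inner_echar_cube:
  assumes "k \<in> Zvec" "l \<in> Zvec"
  shows "L2_inner (echar_cube k) (echar_cube l) = (if k = l then 1 else 0)"
proof -
  have "echar_cube k x * cnj (echar_cube l x) = echar_cube (k - l) x" for x
    by (auto simp: echar_cube_def cnj_echar indicator_def simp flip: echar_add_left)
  then show ?thesis
    using integral_echar_cube[OF Zvec_diff[OF assms]] by (simp add: L2_inner_def)
qed

subsection \<open>Density of trigonometric polynomials\<close>

text \<open>This form makes closure under products a short induction; the finite sum over distinct
  frequencies is recovered in \<open>tpoly_finite_sum\<close>.\<close>

inductive tpoly :: "(real^'d \<Rightarrow> complex) \<Rightarrow> bool" where
  single: "k \<in> Zvec \<Longrightarrow> tpoly (\<lambda>x. a * echar k x)"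
| add: "tpoly f \<Longrightarrow> tpoly g \<Longrightarrow> tpoly (\<lambda>x. f x + g x)"

lemma tpoly_const: "tpoly (\<lambda>x. a)"
  using tpoly.single[OF Zvec_0, of a] by (simp add: echar_0)

lemma tpoly_sum: "(\<And>i. i \<in> S \<Longrightarrow> tpoly (f i)) \<Longrightarrow> tpoly (\<lambda>x. \<Sum>i\<in>S. f i x)"
  by (induction S rule: infinite_finite_induct) (auto intro: tpoly.add tpoly_const)

lemma tpoly_mult_single: "tpoly f \<Longrightarrow> k \<in> Zvec \<Longrightarrow> tpoly (\<lambda>x. (a * echar k x) * f x)"
proof (induction rule: tpoly.induct)
  case (single l b)
  have "(\<lambda>x. (a * echar k x) * (b * echar l x)) = (\<lambda>x. (a * b) * echar (k + l) x)"
    by (simp add: echar_add_left fun_eq_iff)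
  then show ?case using tpoly.single[OF Zvec_add[OF single(2,1)], of "a * b"] by simp
next
  case (add f g)
  then show ?case using tpoly.add by (simp add: distrib_left)
qed

lemma tpoly_mult: "tpoly f \<Longrightarrow> tpoly g \<Longrightarrow> tpoly (\<lambda>x. f x * g x)"
proof (induction rule: tpoly.induct)
  case (single k a)
  then show ?case by (rule tpoly_mult_single[rotated])
next
  case (add f g)
  then show ?case using tpoly.add by (simp add: distrib_right)
qed

lemma tpoly_finite_sum:
  "tpoly f \<Longrightarrow> \<exists>S a. finite S \<and> S \<subseteq> Zvec \<and> f = (\<lambda>x. \<Sum>k\<in>S. a k * echar k x)"
proof (induction rule: tpoly.induct)
  case (single k a)
  then show ?case by (intro exI[of _ "{k}"] exI[of _ "\<lambda>_. a"]) auto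
next
  case (add f g)
  then obtain S a T b where S: "finite S" "S \<subseteq> Zvec" "f = (\<lambda>x. \<Sum>k\<in>S. a k * echar k x)"
    and T: "finite T" "T \<subseteq> Zvec" "g = (\<lambda>x. \<Sum>k\<in>T. b k * echar k x)" by blast
  let ?a = "\<lambda>k. if k \<in> S then a k else 0" and ?b = "\<lambda>k. if k \<in> T then b k else 0"
  have "f x = (\<Sum>k\<in>S \<union> T. ?a k * echar k x)" for x
    unfolding S(3) using S(1) T(1) by (intro sum.mono_neutral_cong_left) auto
  moreover have "g x = (\<Sum>k\<in>S \<union> T. ?b k * echar k x)" for x
    unfolding T(3) using S(1) T(1) by (intro sum.mono_neutral_cong_left) auto
  ultimately have "(\<lambda>x. f x + g x) = (\<lambda>x. \<Sum>k\<in>S \<union> T. (?a k + ?b k) * echar k x)"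
    by (simp add: distrib_right sum.distrib)
  then show ?case using S(1,2) T(1,2) by (intro exI[of _ "S \<union> T"] exI[of _ "\<lambda>k. ?a k + ?b k"]) auto
qed

text \<open>The embedding of \<open>R^d / Z^d\<close> into \<open>C^d\<close> as a product of unit
  circles. Polynomials on its image become trigonometric polynomials, which gives access to
  Stone-Weierstrass.\<close>

definition torus :: "real^'d \<Rightarrow> complex^'d" where
  "torus x = (\<chi> j. echar (axis j 1) x)"

text \<open>Only the linear case has content: a real-linear functional on \<open>C^d\<close> is a
  combination of the real and imaginary parts of the coordinates, and on the torus these are
  combinations of the characters with frequencies \<open>axis j 1\<close> and
  \<open>- axis j 1\<close>.\<close>

lemma tpoly_real_polynomial:
  assumes "real_polynomial_function p"
  shows "tpoly (\<lambda>x. complex_of_real (p (torus x)))"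
  using assms
proof (induction rule: real_polynomial_function.induct)
  case (linear f)
  interpret f: bounded_linear f by fact
  have re: "complex_of_real (Re z) = 1/2 * z + 1/2 * cnj z"
    and im: "complex_of_real (Im z) = (- \<i>/2) * z + (\<i>/2) * cnj z" for z
    by (simp_all add: complex_eq_iff)
  have z_eq: "z = (\<Sum>j\<in>UNIV. Re (z $ j) *\<^sub>R axis j 1 + Im (z $ j) *\<^sub>R axis j \<i>)" for z :: "complex^'a"
  proof -
    have "(\<Sum>j\<in>UNIV. Re (z $ j) *\<^sub>R axis j 1 + Im (z $ j) *\<^sub>R axis j \<i>) $ i
      = (\<Sum>j\<in>UNIV. if j = i then z $ i else 0)" for i
      unfolding sum_component by (rule sum.cong) (auto simp: axis_def complex_eq_iff)
    then show ?thesis by (simp add: vec_eq_iff)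
  qed
  have f_eq: "f z = (\<Sum>j\<in>UNIV. Re (z $ j) * f (axis j 1) + Im (z $ j) * f (axis j \<i>))" for z
  proof -
    have "f z = f (\<Sum>j\<in>UNIV. Re (z $ j) *\<^sub>R axis j 1 + Im (z $ j) *\<^sub>R axis j \<i>)"
      by (rule arg_cong[OF z_eq])
    also have "\<dots> = (\<Sum>j\<in>UNIV. Re (z $ j) * f (axis j 1) + Im (z $ j) * f (axis j \<i>))"
      by (simp add: f.sum f.add f.scaleR)
    finally show ?thesis .
  qed
  have "complex_of_real (f (torus x)) = (\<Sum>j\<in>UNIV.
      ((1/2 * f (axis j 1)) * echar (axis j 1) x + (1/2 * f (axis j 1)) * echar (- axis j 1) x)
      + (((- \<i>/2) * f (axis j \<i>)) * echar (axis j 1) x + ((\<i>/2) * f (axis j \<i>)) * echar (- axis j 1) x))" for x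
    unfolding f_eq[of "torus x"] of_real_sum of_real_add of_real_mult re im
    by (rule sum.cong) (simp_all add: torus_def cnj_echar algebra_simps)
  moreover have "tpoly (\<lambda>x. (\<Sum>j\<in>UNIV.
      ((1/2 * f (axis j 1)) * echar (axis j 1) x + (1/2 * f (axis j 1)) * echar (- axis j 1) x)
      + (((- \<i>/2) * f (axis j \<i>)) * echar (axis j 1) x + ((\<i>/2) * f (axis j \<i>)) * echar (- axis j 1) x)))"
    by (intro tpoly_sum tpoly.add tpoly.single Zvec_axis Zvec_uminus)
  ultimately show ?case by presburger
next
  case (const c)
  show ?case by (rule tpoly_const)
next
  case (add f g)
  then show ?case using tpoly.add by simp
next
  case (mult f g)
  then show ?case using tpoly_mult by simp
qed

lemma torus_eq_iff: "torus x = torus y \<longleftrightarrow> x - y \<in> Zvec"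
proof -
  have "echar (axis j 1) x = echar (axis j 1) y \<longleftrightarrow> (x - y) $ j \<in> \<int>" for j
  proof -
    have "echar (axis j 1) x = echar (axis j 1) y \<longleftrightarrow> (\<exists>n::int. x $ j = y $ j + n)"
    proof -
      have "2 * pi * \<i> * complex_of_real b + of_int (2 * n) * pi * \<i> = 2 * pi * \<i> * complex_of_real (b + n)"
        for b :: real and n :: int by (simp add: algebra_simps)
      then have "2 * pi * \<i> * complex_of_real a = 2 * pi * \<i> * complex_of_real b + of_int (2 * n) * pi * \<i>
          \<longleftrightarrow> a = b + n" for a b :: real and n :: int
        by (simp only: mult_cancel_left of_real_eq_iff) simp
      then show ?thesis unfolding echar_def exp_eq by (simp add: inner_axis')
    qed
    also have "\<dots> \<longleftrightarrow> (x - y) $ j \<in> \<int>"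
      by (auto simp: Ints_def image_iff algebra_simps)
    finally show ?thesis .
  qed
  then show ?thesis by (simp add: torus_def vec_eq_iff Zvec_def)
qed

lemma continuous_on_torus: "continuous_on S torus"
  unfolding torus_def using continuous_on_echar by (intro continuous_on_vec_lambda)

text \<open>Stone-Weierstrass is applied to the function that \<open>\<phi>\<close> induces on the
  image of the cube under \<open>torus\<close>. It is well defined because \<open>torus\<close>
  identifies only points on the faces, where \<open>\<phi>\<close> vanishes.\<close>

lemma tpoly_approx_continuous:
  fixes \<phi> :: "real^'d \<Rightarrow> complex"
  assumes cont: "continuous_on (cbox 0 1) \<phi>" and "e > 0"
    and bdry: "\<And>x j. x \<in> cbox 0 1 \<Longrightarrow> x $ j = 0 \<or> x $ j = 1 \<Longrightarrow> \<phi> x = 0"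
  shows "\<exists>T. tpoly T \<and> (\<forall>x\<in>cbox 0 1. norm (\<phi> x - T x) < e)"
proof -
  let ?Q = "cbox 0 1 :: (real^'d) set"
  define \<psi> where "\<psi> z = \<phi> (inv_into ?Q torus z)" for z
  have inv: "\<phi> x = \<phi> y" if xy: "x \<in> ?Q" "y \<in> ?Q" "torus x = torus y" for x y
  proof (cases "x = y")
    case False
    then obtain j where j: "x $ j \<noteq> y $ j" by (auto simp: vec_eq_iff)
    \<comment> \<open>Two numbers in \<open>[0, 1]\<close> that differ by a nonzero integer are the
      two ends of the interval.\<close>
    have "x $ j - y $ j \<in> \<int>" using xy(3) by (auto simp: torus_eq_iff Zvec_def)
    then have "1 \<le> \<bar>x $ j - y $ j\<bar>" using j by (intro Ints_nonzero_abs_ge1) auto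
    moreover have "0 \<le> x $ j" "x $ j \<le> 1" "0 \<le> y $ j" "y $ j \<le> 1"
      using xy(1,2) by (auto simp: mem_box_cart)
    ultimately have "(x $ j = 0 \<or> x $ j = 1) \<and> (y $ j = 0 \<or> y $ j = 1)" by argo
    then show ?thesis using bdry[OF xy(1)] bdry[OF xy(2)] by metis
  qed simp
  have \<psi>: "\<psi> (torus x) = \<phi> x" if "x \<in> ?Q" for x
    unfolding \<psi>_def using that by (intro inv) (auto intro: inv_into_into f_inv_into_f)
  have compact: "compact (torus ` ?Q)"
    by (intro compact_continuous_image continuous_on_torus compact_cbox)
  \<comment> \<open>Closed subsets of the cube are compact, so their images under
    \<open>torus\<close> are closed; hence closed preimages under \<open>\<phi>\<close> descend to
    closed preimages under \<open>\<psi>\<close>.\<close>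
  have "continuous_on (torus ` ?Q) \<psi>"
    unfolding continuous_on_closed_invariant
  proof (intro allI impI)
    fix B :: "complex set" assume "closed B"
    then have "closed (?Q \<inter> \<phi> -` B)"
      using cont continuous_on_closed_vimage[of ?Q \<phi>] closed_cbox by (metis Int_commute)
    then have "compact (?Q \<inter> \<phi> -` B)"
      by (metis Int_lower1 bounded_cbox bounded_subset compact_eq_bounded_closed)
    then have "closed (torus ` (?Q \<inter> \<phi> -` B))"
      by (intro compact_imp_closed compact_continuous_image continuous_on_torus)
    moreover have "torus ` (?Q \<inter> \<phi> -` B) \<inter> torus ` ?Q = \<psi> -` B \<inter> torus ` ?Q"
      using \<psi> by auto
    ultimately show "\<exists>A. closed A \<and> A \<inter> torus ` ?Q = \<psi> -` B \<inter> torus ` ?Q" by blast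
  qed
  from Stone_Weierstrass_polynomial_function[OF compact this \<open>e > 0\<close>]
  obtain p where p: "polynomial_function p" "\<And>z. z \<in> torus ` ?Q \<Longrightarrow> norm (\<psi> z - p z) < e" by blast
  have "real_polynomial_function (Re \<circ> p)" "real_polynomial_function (Im \<circ> p)"
    using p(1) bounded_linear_Re bounded_linear_Im unfolding polynomial_function_def by blast+
  then have "tpoly (\<lambda>x. complex_of_real ((Re \<circ> p) (torus x)) + \<i> * complex_of_real ((Im \<circ> p) (torus x)))"
    by (intro tpoly.add tpoly_mult tpoly_const tpoly_real_polynomial)
  then have "tpoly (\<lambda>x. p (torus x))" by (simp flip: complex_eq)
  moreover have "norm (\<phi> x - p (torus x)) < e" if "x \<in> ?Q" for x
    using p(2)[of "torus x"] \<psi>[OF that] that by auto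
  ultimately show ?thesis by blast
qed

lemma tpoly_L2: "tpoly T \<Longrightarrow> (\<lambda>x. T x * indicator ucube x) \<in> L2"
proof (induction rule: tpoly.induct)
  case (single k a)
  then show ?case using L2_scale[OF echar_cube_L2, of a k] by (simp add: echar_cube_def mult.assoc)
next
  case (add f g)
  then show ?case using L2_add by (simp add: distrib_right)
qed

text \<open>\<open>F\<close> is an almost everywhere limit of continuous functions. Two corrections
  make these usable: \<open>clip\<close> bounds them by \<open>R\<close> for dominated convergence,
  and \<open>cut\<close> makes them vanish on the faces, as \<open>tpoly_approx_continuous\<close>
  demands.\<close>

lemma tpoly_dense_bounded:
  fixes F :: "real^'d \<Rightarrow> complex"
  assumes F: "F \<in> L2" and off: "\<And>x. x \<notin> ucube \<Longrightarrow> F x = 0"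
    and R: "R > 0" "\<And>x. norm (F x) \<le> R" and "e > 0"
  shows "\<exists>T. tpoly T \<and> L2_norm (\<lambda>x. F x - T x * indicator ucube x) < e"
proof -
  have "F measurable_on UNIV"
    by (rule lebesgue_measurable_imp_measurable_on) (auto intro: L2_measurable F)
  then obtain N g where N: "negligible N" and g: "\<And>n. continuous_on UNIV (g n)"
    and lim: "\<And>x. x \<notin> N \<Longrightarrow> (\<lambda>n. g n x) \<longlonglongrightarrow> F x"
    by (auto simp: measurable_on_def)
  \<comment> \<open>The radial retraction onto the disc of radius \<open>R\<close>, hence the
    identity on the values of \<open>F\<close>.\<close>
  define clip where "clip z = z / complex_of_real (max 1 (norm z / R))" for z
  \<comment> \<open>Zero as soon as one coordinate is \<open>0\<close> or \<open>1\<close>, but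
    equal to \<open>1\<close> at each interior point once \<open>n\<close> is large.\<close>
  define cut where "cut n x = (\<Prod>j\<in>UNIV. min 1 (real n * (x $ j * (1 - x $ j))))" for n and x :: "real^'d"
  define G where "G n x = complex_of_real (cut n x) * clip (g n x)" for n x
  have clip_cont: "continuous_on S clip" for S
    unfolding clip_def using R(1) by (intro continuous_intros) auto
  have clip_bound: "norm (clip z) \<le> R" for z
  proof -
    have "norm z \<le> R * max 1 (norm z / R)" using R(1) by (simp add: max_def field_simps)
    then show ?thesis unfolding clip_def norm_divide norm_of_real using R(1)
      by (simp add: divide_le_eq)
  qed
  have clip_id: "clip z = z" if "norm z \<le> R" for z
    using that R(1) by (simp add: clip_def max_def)
  have cut_cont: "continuous_on S (cut n)" for S n
    unfolding cut_def by (intro continuous_intros)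
  have cut_bound: "0 \<le> cut n x \<and> cut n x \<le> 1" if "x \<in> cbox 0 1" for n x
    using that unfolding cut_def by (auto simp: mem_box_cart intro!: prod_nonneg prod_le_1)
  have cut_lim: "(\<lambda>n. cut n x) \<longlonglongrightarrow> 1" if "x \<in> box 0 1" for x
  proof -
    have "(\<lambda>n. min 1 (real n * (x $ j * (1 - x $ j)))) \<longlonglongrightarrow> 1" for j
    proof (rule tendsto_eventually)
      have "x $ j * (1 - x $ j) > 0" using that by (auto simp: mem_box_cart)
      then obtain n0 where n0: "1 < real n0 * (x $ j * (1 - x $ j))"
        using reals_Archimedean3 by blast
      have "1 \<le> real n * (x $ j * (1 - x $ j))" if "n \<ge> n0" for n
      proof -
        have "real n0 * (x $ j * (1 - x $ j)) \<le> real n * (x $ j * (1 - x $ j))"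
          using that \<open>x $ j * (1 - x $ j) > 0\<close> by (intro mult_right_mono) auto
        with n0 show ?thesis by linarith
      qed
      then show "\<forall>\<^sub>F n in sequentially. min 1 (real n * (x $ j * (1 - x $ j))) = 1"
        unfolding eventually_sequentially by (metis min.absorb1)
    qed
    then have "(\<lambda>n. cut n x) \<longlonglongrightarrow> (\<Prod>j\<in>(UNIV::'d set). 1)"
      unfolding cut_def by (intro tendsto_prod)
    then show ?thesis by simp
  qed
  have G_cont: "continuous_on S (G n)" for S n
    unfolding G_def
    by (intro continuous_intros cut_cont continuous_on_compose2[OF clip_cont[of UNIV]]
        continuous_on_subset[OF g]) auto
  have G_bound: "norm (G n x) \<le> R" if "x \<in> ucube" for n x
  proof -
    have "norm (G n x) \<le> 1 * R" unfolding G_def norm_mult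
      using cut_bound[of x n] that ucube_subset(2) by (intro mult_mono clip_bound) auto
    then show ?thesis by simp
  qed
  let ?G = "\<lambda>n x. G n x * indicator ucube x"
  have Gm: "?G n \<in> borel_measurable lebesgue" for n
    using borel_measurable_continuous_onI[OF G_cont, of n]
    by (intro borel_measurable_times borel_measurable_indicator_ucube measurable_completion) simp
  have GL2: "?G n \<in> L2" for n
  proof (rule L2_I_bound[OF Gm])
    show "integrable lebesgue (\<lambda>x. R\<^sup>2 * indicator (ucube :: (real^'d) set) x)"
      by (simp add: integrable_indicator_ucube)
    show "(norm (?G n x))\<^sup>2 \<le> R\<^sup>2 * indicator ucube x" for x
      using G_bound[of x n] by (auto simp: indicator_def intro!: power_mono)
  qed
  have "(\<lambda>n. L2_norm (\<lambda>x. F x - ?G n x)) \<longlonglongrightarrow> 0"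
  proof (rule L2_norm_tendsto_0[OF L2_measurable[OF F] Gm])
    show "integrable lebesgue (\<lambda>x. (2 * R)\<^sup>2 * indicator (ucube :: (real^'d) set) x)"
      by (simp add: integrable_indicator_ucube)
    show "(norm (F x - ?G n x))\<^sup>2 \<le> (2 * R)\<^sup>2 * indicator ucube x" for n x
    proof (cases "x \<in> ucube")
      case True
      have "norm (F x - G n x) \<le> norm (F x) + norm (G n x)" by (rule norm_triangle_ineq4)
      also have "\<dots> \<le> 2 * R" using R(2)[of x] G_bound[OF True, of n] by simp
      finally have "(norm (F x - G n x))\<^sup>2 \<le> (2 * R)\<^sup>2" by (rule power_mono) simp
      with True show ?thesis by simp
    qed (simp add: off)
    \<comment> \<open>On the faces \<open>cut n\<close> stays \<open>0\<close>, so they are added to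
      the exceptional null set.\<close>
    have "negligible (N \<union> (cbox 0 1 - box 0 1))"
      using N negligible_frontier_interval by (rule negligible_Un)
    moreover have "(\<lambda>n. ?G n x) \<longlonglongrightarrow> F x" if x: "x \<notin> N \<union> (cbox 0 1 - box 0 1)" for x
    proof (cases "x \<in> ucube")
      case True
      then have "x \<in> box 0 1" using x ucube_subset(2) by auto
      have "(\<lambda>n. clip (g n x)) \<longlonglongrightarrow> clip (F x)"
        using clip_cont[of UNIV] lim[of x] x
        by (auto intro!: continuous_on_tendsto_compose[OF clip_cont[of UNIV]])
      then have "(\<lambda>n. G n x) \<longlonglongrightarrow> complex_of_real 1 * clip (F x)"
        unfolding G_def by (intro tendsto_intros cut_lim[OF \<open>x \<in> box 0 1\<close>])
      then show ?thesis using True by (simp add: clip_id R)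
    qed (simp add: off)
    ultimately show "AE x in lebesgue. (\<lambda>n. ?G n x) \<longlonglongrightarrow> F x"
      unfolding negligible_iff_null_sets by (intro AE_I'[of "N \<union> (cbox 0 1 - box 0 1)"]) auto
  qed
  then have "\<forall>\<^sub>F n in sequentially. dist (L2_norm (\<lambda>x. F x - ?G n x)) 0 < e / 2"
    using \<open>e > 0\<close> by (intro tendstoD) auto
  then obtain n where n: "L2_norm (\<lambda>x. F x - ?G n x) < e / 2"
    using eventually_happens'[OF sequentially_bot] by (auto simp: L2_norm_nonneg)
  have "G n x = 0" if "x $ j = 0 \<or> x $ j = 1" for x j
  proof -
    have "min 1 (real n * (x $ j * (1 - x $ j))) = 0" using that by auto
    then have "cut n x = 0" unfolding cut_def by (metis (mono_tags, lifting) UNIV_I finite prod_zero)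
    then show ?thesis by (simp add: G_def)
  qed
  then obtain T where T: "tpoly T" "\<And>x. x \<in> cbox 0 1 \<Longrightarrow> norm (G n x - T x) < e / 2"
    using tpoly_approx_continuous[OF G_cont[of _ n], of "e / 2"] \<open>e > 0\<close> by (metis half_gt_zero)
  \<comment> \<open>The cube has measure 1, so a uniform error of \<open>e / 2\<close> is at most
    \<open>e / 2\<close> in norm.\<close>
  have "(L2_norm (\<lambda>x. ?G n x - T x * indicator ucube x))\<^sup>2 \<le> (LINT x|lebesgue. (e/2)\<^sup>2 * indicator (ucube :: (real^'d) set) x)"
    unfolding L2_norm_power2
  proof (rule integral_mono)
    show "integrable lebesgue (\<lambda>x. (norm (?G n x - T x * indicator ucube x))\<^sup>2)"
      by (intro L2_integrable L2_diff GL2 tpoly_L2 T)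
    show "integrable lebesgue (\<lambda>x. (e/2)\<^sup>2 * indicator (ucube :: (real^'d) set) x)"
      by (simp add: integrable_indicator_ucube)
    show "(norm (?G n x - T x * indicator ucube x))\<^sup>2 \<le> (e/2)\<^sup>2 * indicator ucube x" for x
    proof (cases "x \<in> ucube")
      case True
      then have "norm (G n x - T x) \<le> e / 2" using T(2)[OF subsetD[OF ucube_subset(2) True]] by simp
      then have "(norm (G n x - T x))\<^sup>2 \<le> (e / 2)\<^sup>2" by (rule power_mono) simp
      then show ?thesis using True by simp
    qed simp
  qed
  also have "\<dots> = (e/2)\<^sup>2" by (simp add: measure_ucube)
  finally have "L2_norm (\<lambda>x. ?G n x - T x * indicator ucube x) \<le> e / 2"
    using \<open>e > 0\<close> by (elim power2_le_imp_le) simp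
  moreover have "L2_norm (\<lambda>x. F x - T x * indicator ucube x) \<le>
      L2_norm (\<lambda>x. F x - ?G n x) + L2_norm (\<lambda>x. ?G n x - T x * indicator ucube x)"
    by (intro L2_norm_triangle_diff F GL2 tpoly_L2 T)
  ultimately show ?thesis using n T(1) by (intro exI[of _ T]) auto
qed

lemma tpoly_dense:
  fixes F :: "real^'d \<Rightarrow> complex"
  assumes F: "F \<in> L2" and off: "\<And>x. x \<notin> ucube \<Longrightarrow> F x = 0" and "e > 0"
  shows "\<exists>T. tpoly T \<and> L2_norm (\<lambda>x. F x - T x * indicator ucube x) < e"
proof -
  define Fk where "Fk k x = (if norm (F x) \<le> real k then F x else 0)" for k :: nat and x
  have meas: "Fk k \<in> borel_measurable lebesgue" for k
  proof -
    have [measurable]: "F \<in> borel_measurable lebesgue" by (rule L2_measurable[OF F])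
    show ?thesis unfolding Fk_def by measurable
  qed
  have L2: "Fk k \<in> L2" for k
    by (rule L2_I_bound[OF meas L2_integrable[OF F]]) (auto simp: Fk_def)
  have "(\<lambda>k. L2_norm (\<lambda>x. F x - Fk k x)) \<longlonglongrightarrow> 0"
  proof (rule L2_norm_tendsto_0[OF L2_measurable[OF F] meas L2_integrable[OF F]])
    show "AE x in lebesgue. (\<lambda>k. Fk k x) \<longlonglongrightarrow> F x"
    proof (rule AE_I2, rule tendsto_eventually)
      fix x
      obtain k0 where "norm (F x) \<le> real k0" using real_arch_simple by blast
      then show "\<forall>\<^sub>F k in sequentially. Fk k x = F x"
        unfolding eventually_sequentially Fk_def by (intro exI[of _ k0]) auto
    qed
  qed (auto simp: Fk_def)
  then have "\<forall>\<^sub>F k in sequentially. dist (L2_norm (\<lambda>x. F x - Fk k x)) 0 < e / 2"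
    using \<open>e > 0\<close> by (intro tendstoD) auto
  then obtain k where k: "L2_norm (\<lambda>x. F x - Fk k x) < e / 2"
    using eventually_happens'[OF sequentially_bot] by (auto simp: L2_norm_nonneg)
  \<comment> \<open>The summand 1 keeps the bound positive when \<open>k = 0\<close>.\<close>
  have "norm (Fk k x) \<le> real k + 1" for x by (auto simp: Fk_def)
  then obtain T where T: "tpoly T" "L2_norm (\<lambda>x. Fk k x - T x * indicator ucube x) < e / 2"
    using tpoly_dense_bounded[OF L2, of k "real k + 1" "e / 2"] \<open>e > 0\<close> off by (auto simp: Fk_def)
  have "L2_norm (\<lambda>x. F x - T x * indicator ucube x) \<le>
      L2_norm (\<lambda>x. F x - Fk k x) + L2_norm (\<lambda>x. Fk k x - T x * indicator ucube x)"
    by (intro L2_norm_triangle_diff F L2 tpoly_L2 T)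
  then show ?thesis using k T by (intro exI[of _ T]) auto
qed

subsection \<open>Parseval's identity\<close>

lemma L2_inner_echar_cube_sum:
  assumes "finite S" "S \<subseteq> Zvec" "k \<in> S"
  shows "L2_inner (\<lambda>x. \<Sum>m\<in>S. b m * echar_cube m x) (echar_cube k) = b k"
proof -
  have "L2_inner (\<lambda>x. \<Sum>m\<in>S. b m * echar_cube m x) (echar_cube k)
      = (\<Sum>m\<in>S. b m * L2_inner (echar_cube m) (echar_cube k))"
    by (subst L2_inner_sum_left) (auto intro: L2_scale echar_cube_L2 simp: L2_inner_scale_left)
  also have "\<dots> = (\<Sum>m\<in>S. if m = k then b k else 0)"
    using assms by (intro sum.cong) (auto simp: L2_inner_echar_cube subset_iff)
  finally show ?thesis using assms by simp
qed

text \<open>Pythagoras for the orthonormal system. The last sum vanishes for \<open>b = c\<close>,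
  so the Fourier coefficients give the best approximation with frequencies in
  \<open>S\<close>.\<close>

lemma L2_norm_diff_echar_cube_sum:
  fixes F :: "real^'d \<Rightarrow> complex"
  assumes F: "F \<in> L2" and S: "finite S" "S \<subseteq> Zvec"
  defines "c \<equiv> \<lambda>m. L2_inner F (echar_cube m)"
  shows "(L2_norm (\<lambda>x. F x - (\<Sum>m\<in>S. b m * echar_cube m x)))\<^sup>2
      = (L2_norm F)\<^sup>2 - (\<Sum>m\<in>S. (norm (c m))\<^sup>2) + (\<Sum>m\<in>S. (norm (c m - b m))\<^sup>2)"
proof -
  let ?G = "\<lambda>x. \<Sum>m\<in>S. b m * echar_cube m x"
  have G: "?G \<in> L2" by (intro L2_sum L2_scale echar_cube_L2)
  have inner: "L2_inner U ?G = (\<Sum>m\<in>S. cnj (b m) * L2_inner U (echar_cube m))" if "U \<in> L2" for U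
  proof -
    have "L2_inner ?G U = (\<Sum>m\<in>S. b m * L2_inner (echar_cube m) U)"
      using that by (subst L2_inner_sum_left) (auto intro: L2_scale echar_cube_L2 simp: L2_inner_scale_left)
    then have "cnj (L2_inner ?G U) = (\<Sum>m\<in>S. cnj (b m) * cnj (L2_inner (echar_cube m) U))" by simp
    then show ?thesis by (simp only: L2_inner_cnj)
  qed
  have GG: "complex_of_real ((L2_norm ?G)\<^sup>2) = (\<Sum>m\<in>S. cnj (b m) * b m)"
    unfolding L2_inner_self[symmetric] inner[OF G]
    using S by (intro sum.cong) (auto simp: L2_inner_echar_cube_sum)
  also have "\<dots> = complex_of_real (\<Sum>m\<in>S. (norm (b m))\<^sup>2)"
    by (simp only: of_real_sum complex_norm_square mult.commute)
  finally have nG: "(L2_norm ?G)\<^sup>2 = (\<Sum>m\<in>S. (norm (b m))\<^sup>2)" by (simp only: of_real_eq_iff)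
  have "(norm (c m - b m))\<^sup>2 = (norm (c m))\<^sup>2 - 2 * Re (cnj (b m) * c m) + (norm (b m))\<^sup>2" for m
    by (simp only: cmod_power2) (simp add: power2_eq_square algebra_simps)
  then have "(\<Sum>m\<in>S. (norm (c m - b m))\<^sup>2)
      = (\<Sum>m\<in>S. (norm (c m))\<^sup>2) - 2 * Re (L2_inner F ?G) + (\<Sum>m\<in>S. (norm (b m))\<^sup>2)"
    unfolding inner[OF F] c_def by (simp add: sum.distrib sum_subtractf sum_distrib_left)
  then show ?thesis
    unfolding L2_norm_power2_diff[OF F G] nG by simp
qed

text \<open>Density and best approximation make the Fourier sums converge to \<open>F\<close> in
  norm, and by Cauchy-Schwarz this survives pairing with \<open>U\<close>. The values of
  \<open>U\<close> off the cube never enter, since \<open>F\<close> and all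
  \<open>echar_cube m\<close> vanish there.\<close>

lemma parseval_cube:
  fixes F U :: "real^'d \<Rightarrow> complex"
  assumes F: "F \<in> L2" "\<And>x. x \<notin> ucube \<Longrightarrow> F x = 0" and U: "U \<in> L2"
  shows "((\<lambda>m. L2_inner F (echar_cube m) * cnj (L2_inner U (echar_cube m))) has_sum L2_inner F U) Zvec"
  unfolding has_sum_def tendsto_iff eventually_finite_subsets_at_top
proof (intro allI impI)
  fix e :: real assume "e > 0"
  let ?c = "\<lambda>m. L2_inner F (echar_cube m)"
  \<comment> \<open>The summand 1 avoids division by a zero norm.\<close>
  let ?n = "L2_norm U + 1"
  have n: "?n > 0" using L2_norm_nonneg[of U] by linarith
  then obtain T where T: "tpoly T" "L2_norm (\<lambda>x. F x - T x * indicator ucube x) < e / ?n"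
    using tpoly_dense[OF F, of "e / ?n"] \<open>e > 0\<close> by auto
  obtain S0 a where S0: "finite S0" "S0 \<subseteq> Zvec" "T = (\<lambda>x. \<Sum>k\<in>S0. a k * echar k x)"
    using tpoly_finite_sum[OF T(1)] by blast
  have "dist (\<Sum>m\<in>S. ?c m * cnj (L2_inner U (echar_cube m))) (L2_inner F U) < e"
    if S: "finite S" "S0 \<subseteq> S" "S \<subseteq> Zvec" for S
  proof -
    let ?s = "\<lambda>x. \<Sum>m\<in>S. ?c m * echar_cube m x"
    let ?a = "\<lambda>k. if k \<in> S0 then a k else 0"
    have s: "?s \<in> L2" by (intro L2_sum L2_scale echar_cube_L2)
    have "T x * indicator ucube x = (\<Sum>m\<in>S. ?a m * echar_cube m x)" for x
      unfolding S0(3) echar_cube_def sum_distrib_right using S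
      by (intro sum.mono_neutral_cong_left) auto
    \<comment> \<open>Over any \<open>S\<close> containing \<open>S0\<close>, \<open>T\<close> is a
      competitor with some zero coefficients, so the Fourier sum over \<open>S\<close> is at least
      as close to \<open>F\<close>.\<close>
    then have "(L2_norm (\<lambda>x. F x - ?s x))\<^sup>2 \<le> (L2_norm (\<lambda>x. F x - T x * indicator ucube x))\<^sup>2"
      using L2_norm_diff_echar_cube_sum[OF F(1) S(1,3)] by (simp add: sum_nonneg)
    then have "L2_norm (\<lambda>x. F x - ?s x) \<le> L2_norm (\<lambda>x. F x - T x * indicator ucube x)"
      by (rule power2_le_imp_le) (rule L2_norm_nonneg)
    with T(2) have small: "L2_norm (\<lambda>x. F x - ?s x) < e / ?n" by linarith
    have "L2_inner (\<lambda>x. F x - ?s x) U = L2_inner F U - (\<Sum>m\<in>S. ?c m * cnj (L2_inner U (echar_cube m)))"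
      unfolding L2_inner_diff_left[OF F(1) s U]
      by (subst L2_inner_sum_left) (auto intro: L2_scale echar_cube_L2 U simp: L2_inner_scale_left L2_inner_cnj)
    then have "dist (\<Sum>m\<in>S. ?c m * cnj (L2_inner U (echar_cube m))) (L2_inner F U)
        = norm (L2_inner (\<lambda>x. F x - ?s x) U)" by (simp add: dist_norm norm_minus_commute)
    also have "\<dots> \<le> L2_norm (\<lambda>x. F x - ?s x) * L2_norm U"
      by (intro L2_cauchy_schwarz L2_diff F U s)
    also have "\<dots> \<le> L2_norm (\<lambda>x. F x - ?s x) * ?n"
      by (intro mult_left_mono) (auto simp: L2_norm_nonneg)
    also have "\<dots> < e" using small n by (simp add: pos_less_divide_eq)
    finally show ?thesis .
  qed
  then show "\<exists>X. finite X \<and> X \<subseteq> Zvec \<and> (\<forall>Y. finite Y \<and> X \<subseteq> Y \<and> Y \<subseteq> Zvec \<longrightarrow>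
      dist (\<Sum>m\<in>Y. ?c m * cnj (L2_inner U (echar_cube m))) (L2_inner F U) < e)"
    using S0 by blast
qed

definition periodize :: "(real^'d) set \<Rightarrow> (real^'d \<Rightarrow> complex) \<Rightarrow> real^'d \<Rightarrow> complex" where
  "periodize K F y = (\<Sum>k\<in>K. F (k + y)) * indicator ucube y"

lemma L2_vanish_integrable:
  assumes F: "F \<in> L2" and A: "bounded A" "\<And>x. x \<notin> A \<Longrightarrow> F x = 0"
  shows "integrable lebesgue F"
proof -
  obtain R where R: "A \<subseteq> cball 0 R" using A(1) unfolding bounded_iff by (metis mem_cball_0 subsetI)
  have "(\<lambda>x::real^'a. indicator (cball 0 R) x :: complex) \<in> L2"
  proof (rule L2_I_bound)
    show "integrable lebesgue (indicator (cball 0 R) :: (real^'a) \<Rightarrow> real)"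
      using lmeasurable_cball[of "0::real^'a" R]
      by (intro integrable_real_indicator) (auto simp: fmeasurable_def)
    show "(\<lambda>x::real^'a. indicator (cball 0 R) x :: complex) \<in> borel_measurable lebesgue"
      by (intro borel_measurable_indicator) simp
  qed (auto simp: indicator_def)
  from L2_mult_integrable[OF F this]
  have "integrable lebesgue (\<lambda>x. F x * cnj (indicator (cball 0 R) x))" .
  moreover have "F x * cnj (indicator (cball 0 R) x) = F x" for x
    by (cases "x \<in> A") (use R A(2)[of x] in \<open>auto simp: indicator_def\<close>)
  ultimately show ?thesis by simp
qed

lemma bounded_imp_finite_vfloor:
  assumes "bounded (A :: (real^'d) set)"
  obtains K where "finite K" "K \<subseteq> Zvec" "\<And>x. x \<in> A \<Longrightarrow> vfloor x \<in> K"
proof -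
  obtain R where R: "\<And>x. x \<in> A \<Longrightarrow> norm x \<le> R" using assms bounded_iff by blast
  let ?K = "{k\<in>Zvec. \<forall>j. \<bar>k $ j\<bar> \<le> R + 1} :: (real^'d) set"
  have "vfloor x \<in> ?K" if "x \<in> A" for x
  proof -
    have "\<bar>of_int \<lfloor>x $ j\<rfloor>\<bar> \<le> R + 1" for j
      using order_trans[OF component_le_norm_cart[of x j] R[OF that]] by linarith
    then show ?thesis using vfloor_Zvec[of x] by (simp add: vfloor_def)
  qed
  then show ?thesis using finite_Zvec_bounded[of "R + 1"] that[of ?K] by blast
qed

text \<open>The integer translates of \<open>A\<close> do not overlap, so all cross terms with
  \<open>k \<noteq> l\<close> vanish. Compatibility with products is what makes periodisation
  preserve inner products.\<close>

lemma periodize_mult: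
  assumes K: "finite K" "K \<subseteq> Zvec"
    and pack: "\<And>x y. x \<in> A \<Longrightarrow> y \<in> A \<Longrightarrow> x - y \<in> Zvec \<Longrightarrow> x = y"
    and off: "\<And>x. x \<notin> A \<Longrightarrow> F x = 0" "\<And>x. x \<notin> A \<Longrightarrow> U x = 0"
  shows "periodize K F y * cnj (periodize K U y) = periodize K (\<lambda>x. F x * cnj (U x)) y"
proof -
  have "(\<Sum>k\<in>K. F (k + y)) * (\<Sum>l\<in>K. cnj (U (l + y))) = (\<Sum>k\<in>K. \<Sum>l\<in>K. F (k + y) * cnj (U (l + y)))"
    by (rule sum_product)
  also have "\<dots> = (\<Sum>k\<in>K. \<Sum>l\<in>K. if l = k then F (k + y) * cnj (U (k + y)) else 0)"
  proof (intro sum.cong refl)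
    fix k l assume kl: "k \<in> K" "l \<in> K"
    show "F (k + y) * cnj (U (l + y)) = (if l = k then F (k + y) * cnj (U (k + y)) else 0)"
    proof (cases "F (k + y) = 0 \<or> U (l + y) = 0")
      case False
      then have "k + y \<in> A" "l + y \<in> A" using off by blast+
      moreover have "(k + y) - (l + y) \<in> Zvec" using kl K Zvec_diff[of k l] by (auto simp: subset_iff)
      ultimately have "k = l" using pack by fastforce
      then show ?thesis by simp
    qed auto
  qed
  also have "\<dots> = (\<Sum>k\<in>K. F (k + y) * cnj (U (k + y)))" using K by simp
  finally show ?thesis by (simp add: periodize_def indicator_def)
qed

text \<open>Periodisation carries functions on \<open>A\<close> isometrically to functions on the
  unit cube. It also preserves the coefficients, because \<open>echar m\<close> is invariant under
  integer shifts, so Parseval on the cube applies.\<close>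

lemma parseval_packing:
  fixes F U :: "real^'d \<Rightarrow> complex"
  assumes A: "bounded A" and pack: "\<And>x y. x \<in> A \<Longrightarrow> y \<in> A \<Longrightarrow> x - y \<in> Zvec \<Longrightarrow> x = y"
    and F: "F \<in> L2" "\<And>x. x \<notin> A \<Longrightarrow> F x = 0" and U: "U \<in> L2" "\<And>x. x \<notin> A \<Longrightarrow> U x = 0"
  shows "((\<lambda>m. (LINT x|lebesgue. F x * cnj (echar m x)) * cnj (LINT x|lebesgue. U x * cnj (echar m x)))
     has_sum L2_inner F U) Zvec"
proof -
  obtain K where K: "finite K" "K \<subseteq> Zvec" "\<And>x. x \<in> A \<Longrightarrow> vfloor x \<in> K"
    using bounded_imp_finite_vfloor[OF A] by blast
  have meas: "periodize K V \<in> borel_measurable lebesgue" if "V \<in> L2" for V :: "real^'d \<Rightarrow> complex"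
    using borel_measurable_translation[OF L2_measurable[OF that]] unfolding periodize_def
    by (intro borel_measurable_times borel_measurable_sum borel_measurable_indicator_ucube)
  have int: "integrable lebesgue (periodize K V)"
       "(LINT x|lebesgue. V x) = (LINT x|lebesgue. periodize K V x)"
    if "integrable lebesgue V" "\<And>x. x \<notin> A \<Longrightarrow> V x = 0" for V
    using integral_periodize[OF that(1) K(1,2)] that(2) K(3) unfolding periodize_def by blast+
  have inner: "L2_inner V W = L2_inner (periodize K V) (periodize K W)"
    if "V \<in> L2" "\<And>x. x \<notin> A \<Longrightarrow> V x = 0" "W \<in> L2" "\<And>x. x \<notin> A \<Longrightarrow> W x = 0" for V W
    using int(2)[OF L2_mult_integrable[OF that(1,3)]] that(2)
    unfolding L2_inner_def by (simp add: periodize_mult[OF K(1,2) pack that(2,4)])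
  have L2: "periodize K V \<in> L2" if V: "V \<in> L2" "\<And>x. x \<notin> A \<Longrightarrow> V x = 0" for V
  proof -
    have "integrable lebesgue (\<lambda>x. norm (periodize K (\<lambda>x. V x * cnj (V x)) x))"
      using int(1)[OF L2_mult_integrable[OF V(1) V(1)]] V(2) by (intro integrable_norm) auto
    moreover have "norm (periodize K (\<lambda>x. V x * cnj (V x)) x) = (norm (periodize K V x))\<^sup>2" for x
      by (simp add: periodize_mult[OF K(1,2) pack V(2) V(2), symmetric] norm_mult power2_eq_square)
    ultimately show ?thesis using meas[OF V(1)] by (simp add: L2_def)
  qed
  have coef: "(LINT x|lebesgue. V x * cnj (echar m x)) = L2_inner (periodize K V) (echar_cube m)"
    if V: "V \<in> L2" "\<And>x. x \<notin> A \<Longrightarrow> V x = 0" and m: "m \<in> Zvec" for V m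
  proof -
    have "integrable lebesgue (\<lambda>x. V x * cnj (echar m x))"
    proof (rule Bochner_Integration.integrable_bound[OF L2_vanish_integrable[OF V(1) A V(2)]])
      show "(\<lambda>x. V x * cnj (echar m x)) \<in> borel_measurable lebesgue"
        unfolding cnj_echar by (intro borel_measurable_times L2_measurable V borel_measurable_echar)
    qed (auto simp: norm_mult norm_echar)
    then have "(LINT x|lebesgue. V x * cnj (echar m x)) = (LINT x|lebesgue. periodize K (\<lambda>x. V x * cnj (echar m x)) x)"
      using V(2) by (intro int(2)) auto
    also have "\<dots> = (LINT x|lebesgue. periodize K V x * cnj (echar_cube m x))"
    proof (rule Bochner_Integration.integral_cong)
      fix y
      have "(\<Sum>k\<in>K. V (k + y) * cnj (echar m (k + y))) = (\<Sum>k\<in>K. V (k + y) * cnj (echar m y))"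
        using K(2) m by (intro sum.cong) (auto simp: echar_add_right echar_Zvec)
      then show "periodize K (\<lambda>x. V x * cnj (echar m x)) y = periodize K V y * cnj (echar_cube m y)"
        by (simp add: periodize_def echar_cube_def sum_distrib_right indicator_def)
    qed simp
    finally show ?thesis by (simp add: L2_inner_def)
  qed
  have sum: "((\<lambda>m. L2_inner (periodize K F) (echar_cube m) * cnj (L2_inner (periodize K U) (echar_cube m)))
      has_sum L2_inner (periodize K F) (periodize K U)) Zvec"
    by (intro parseval_cube L2 F U) (simp_all add: periodize_def)
  have eq: "L2_inner F U = L2_inner (periodize K F) (periodize K U)"
    by (rule inner[OF F U])
  have coefs: "L2_inner (periodize K F) (echar_cube m) * cnj (L2_inner (periodize K U) (echar_cube m))
      = (LINT x|lebesgue. F x * cnj (echar m x)) * cnj (LINT x|lebesgue. U x * cnj (echar m x))"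
    if "m \<in> Zvec" for m
    using coef[OF F that] coef[OF U that] by simp
  show ?thesis
    unfolding eq by (rule has_sum_cong[THEN iffD1, OF coefs sum])
qed

text \<open>For \<open>x = (B^T)^{-1} y\<close> one has
  \<open>(B m) \<bullet> x = m \<bullet> y\<close>, which reduces to the integer lattice. Each of
  the two coefficients contributes the Jacobian \<open>1 / \<bar>det B\<bar>\<close> and the inner
  product contributes it once, so one factor remains.\<close>

lemma parseval_lattice:
  fixes F U :: "real^'d \<Rightarrow> complex" and B :: "real^'d^'d"
  assumes B: "invertible B" and A: "bounded A"
    and pack: "\<And>x y n. x \<in> A \<Longrightarrow> y \<in> A \<Longrightarrow> n \<in> Zvec \<Longrightarrow> x - y = matrix_inv (transpose B) *v n \<Longrightarrow> n = 0"
    and F: "F \<in> L2" "\<And>x. x \<notin> A \<Longrightarrow> F x = 0" and U: "U \<in> L2" "\<And>x. x \<notin> A \<Longrightarrow> U x = 0"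
  shows "((\<lambda>m. (LINT x|lebesgue. F x * cnj (echar (B *v m) x)) * cnj (LINT x|lebesgue. U x * cnj (echar (B *v m) x)))
     has_sum (L2_inner F U / \<bar>det B\<bar>)) Zvec"
proof -
  let ?T = "matrix_inv (transpose B)"
  let ?d = "\<bar>det ?T\<bar>"
  have tB: "invertible (transpose B)" using B by (simp add: transpose_invertible)
  have T: "invertible ?T" using matrix_inv[OF tB] unfolding invertible_def by blast
  have BT: "transpose B *v (?T *v x) = x" "?T *v (transpose B *v x) = x" for x
    unfolding matrix_vector_mul_assoc matrix_inv[OF tB] by simp_all
  have "det (transpose B) * det ?T = 1" by (metis det_I det_mul matrix_inv(1)[OF tB])
  then have "det B * det ?T = 1" by (simp add: det_transpose)
  then have "\<bar>det B\<bar> * ?d = 1" by (metis abs_mult abs_one)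
  then have d: "?d = 1 / \<bar>det B\<bar>" "det B \<noteq> 0"
    by (auto simp: eq_divide_eq mult.commute)
  have L2: "(\<lambda>y. V (?T *v y)) \<in> L2" if "V \<in> L2" for V :: "real^'d \<Rightarrow> complex"
  proof -
    have m: "(\<lambda>x. (norm (V x))\<^sup>2) \<in> borel_measurable lebesgue"
      using L2_integrable[OF that] by (rule borel_measurable_integrable)
    then have "integrable lebesgue (\<lambda>y. (norm (V (?T *v y)))\<^sup>2)"
      using integrable_matrix_iff[OF T m] L2_integrable[OF that] by blast
    then show ?thesis
      using borel_measurable_matrix[OF T L2_measurable[OF that]] by (simp add: L2_def)
  qed
  have coef: "(LINT x|lebesgue. V x * cnj (echar (B *v m) x)) = ?d * (LINT y|lebesgue. V (?T *v y) * cnj (echar m y))"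
    if "V \<in> L2" for V m
  proof -
    have "(B *v m) \<bullet> (?T *v y) = m \<bullet> y" for y
      by (metis BT(1) dot_lmul_matrix inner_commute transpose_matrix_vector transpose_transpose)
    then have "echar (B *v m) (?T *v y) = echar m y" for y by (simp add: echar_def)
    moreover have meas: "(\<lambda>x. V x * cnj (echar (B *v m) x)) \<in> borel_measurable lebesgue"
      unfolding cnj_echar using that by (intro borel_measurable_times L2_measurable borel_measurable_echar)
    ultimately show ?thesis
      unfolding integral_matrix[OF T meas] by (simp add: scaleR_conv_of_real)
  qed
  have inner: "L2_inner F U = ?d * L2_inner (\<lambda>y. F (?T *v y)) (\<lambda>y. U (?T *v y))"
    unfolding L2_inner_def
    using integral_matrix[OF T borel_measurable_integrable[OF L2_mult_integrable[OF F(1) U(1)]]]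
    by (simp add: scaleR_conv_of_real)
  have base: "((\<lambda>m. (LINT y|lebesgue. F (?T *v y) * cnj (echar m y)) * cnj (LINT y|lebesgue. U (?T *v y) * cnj (echar m y)))
     has_sum L2_inner (\<lambda>y. F (?T *v y)) (\<lambda>y. U (?T *v y))) Zvec"
  proof (rule parseval_packing[where A = "(*v) (transpose B) ` A"])
    show "bounded ((*v) (transpose B) ` A)"
      by (intro bounded_linear_image A linear_linear[THEN iffD2] matrix_vector_mul_linear)
    show "x = y" if "x \<in> (*v) (transpose B) ` A" "y \<in> (*v) (transpose B) ` A" "x - y \<in> Zvec" for x y
    proof -
      have "?T *v x \<in> A" "?T *v y \<in> A" using that BT(2) by (metis imageE)+
      moreover have "?T *v x - ?T *v y = ?T *v (x - y)" by (simp add: matrix_vector_mult_diff_distrib)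
      ultimately have "x - y = 0" using pack that(3) by blast
      then show ?thesis by simp
    qed
    show "F (?T *v x) = 0" "U (?T *v x) = 0" if "x \<notin> (*v) (transpose B) ` A" for x
      using that BT(1)[of x] F(2)[of "?T *v x"] U(2)[of "?T *v x"] by (metis imageI)+
  qed (use F U L2 in auto)
  have terms: "complex_of_real ?d * complex_of_real ?d * (a * cnj b) = (?d * a) * cnj (?d * b)" for a b :: complex
    by (simp add: mult_ac)
  have total: "complex_of_real ?d * complex_of_real ?d * L2_inner (\<lambda>y. F (?T *v y)) (\<lambda>y. U (?T *v y))
      = L2_inner F U / \<bar>det B\<bar>"
    unfolding inner mult.assoc using d(1) by simp
  show ?thesis
    using has_sum_cmult_right[OF base, of "complex_of_real ?d * complex_of_real ?d"]
    unfolding total by (simp only: terms coef[OF F(1)] coef[OF U(1)])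
qed

subsection \<open>Dual frames from weak reconstruction\<close>

lemma bessel_seqI:
  assumes L2: "\<And>i. i \<in> I \<Longrightarrow> fs i \<in> L2"
    and bound: "\<And>f S. f \<in> L2 \<Longrightarrow> finite S \<Longrightarrow> S \<subseteq> I \<Longrightarrow>
      (\<Sum>i\<in>S. (norm (L2_inner f (fs i)))\<^sup>2) \<le> C * (L2_norm f)\<^sup>2"
  shows "bessel_seq I fs"
  unfolding bessel_seq_def
proof (intro conjI ballI exI[of _ C] L2)
  fix f :: "real^'b \<Rightarrow> complex" assume f: "f \<in> L2"
  show "(\<lambda>i. (norm (L2_inner f (fs i)))\<^sup>2) summable_on I"
    by (rule nonneg_bdd_above_summable_on) (auto intro!: bdd_aboveI2 bound[OF f])
  then show "(\<Sum>\<^sub>\<infinity>i\<in>I. (norm (L2_inner f (fs i)))\<^sup>2) \<le> C * (L2_norm f)\<^sup>2"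
    by (rule infsum_le_finite_sums) (rule bound[OF f])
qed

lemma bessel_seq_finite_bound:
  assumes "bessel_seq I fs"
  obtains C where "C > 0" "\<And>f S. f \<in> L2 \<Longrightarrow> finite S \<Longrightarrow> S \<subseteq> I \<Longrightarrow>
      (\<Sum>i\<in>S. (norm (L2_inner f (fs i)))\<^sup>2) \<le> C * (L2_norm f)\<^sup>2"
proof -
  obtain C where C: "\<And>f. f \<in> L2 \<Longrightarrow> (\<lambda>i. (norm (L2_inner f (fs i)))\<^sup>2) summable_on I \<and>
                  (\<Sum>\<^sub>\<infinity>i\<in>I. (norm (L2_inner f (fs i)))\<^sup>2) \<le> C * (L2_norm f)\<^sup>2"
    using assms unfolding bessel_seq_def by blast
  have "(\<Sum>i\<in>S. (norm (L2_inner f (fs i)))\<^sup>2) \<le> (\<bar>C\<bar> + 1) * (L2_norm f)\<^sup>2"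
    if "f \<in> L2" "finite S" "S \<subseteq> I" for f S
  proof -
    have "(\<Sum>i\<in>S. (norm (L2_inner f (fs i)))\<^sup>2) \<le> (\<Sum>\<^sub>\<infinity>i\<in>I. (norm (L2_inner f (fs i)))\<^sup>2)"
      using C[OF that(1)] that by (intro finite_sum_le_infsum) auto
    also have "\<dots> \<le> C * (L2_norm f)\<^sup>2" using C[OF that(1)] by blast
    also have "\<dots> \<le> (\<bar>C\<bar> + 1) * (L2_norm f)\<^sup>2" by (intro mult_right_mono) auto
    finally show ?thesis .
  qed
  then show ?thesis using that[of "\<bar>C\<bar> + 1"] by auto
qed

text \<open>Testing the residual of a partial sum against itself turns weak reconstruction into norm
  convergence: the residual is bounded by the tail of the coefficients.\<close>

lemma dual_frames_weakI:
  fixes gs hs :: "'i \<Rightarrow> real^'d \<Rightarrow> complex"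
  assumes g: "bessel_seq I gs" and h: "bessel_seq I hs"
    and weak: "\<And>f u. f \<in> L2 \<Longrightarrow> u \<in> L2 \<Longrightarrow>
      ((\<lambda>i. L2_inner f (hs i) * cnj (L2_inner u (gs i))) has_sum L2_inner f u) I"
  shows "dual_frames I gs hs"
  unfolding dual_frames_def
proof (intro conjI g h ballI allI impI)
  fix f :: "real^'d \<Rightarrow> complex" and e :: real
  assume f: "f \<in> L2" and e: "e > 0"
  let ?c = "\<lambda>i. L2_inner f (hs i)"
  have gL2: "gs i \<in> L2" if "i \<in> I" for i using g that by (auto simp: bessel_seq_def)
  obtain C where C: "C > 0" "\<And>u S. u \<in> L2 \<Longrightarrow> finite S \<Longrightarrow> S \<subseteq> I \<Longrightarrow>
      (\<Sum>i\<in>S. (norm (L2_inner u (gs i)))\<^sup>2) \<le> C * (L2_norm u)\<^sup>2"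
    using bessel_seq_finite_bound[OF g] by blast
  \<comment> \<open>Chosen so that the final bound \<open>sqrt (\<delta> * C)\<close> is
    \<open>e / sqrt 2\<close>, strictly below \<open>e\<close>.\<close>
  define \<delta> where "\<delta> = e\<^sup>2 / (2 * C)"
  have \<delta>: "\<delta> > 0" using C(1) e by (simp add: \<delta>_def)
  have summ: "(\<lambda>i. (norm (?c i))\<^sup>2) summable_on I"
    using h f by (auto simp: bessel_seq_def)
  let ?T = "\<Sum>\<^sub>\<infinity>i\<in>I. (norm (?c i))\<^sup>2"
  obtain F0 where F0: "finite F0" "F0 \<subseteq> I" "dist (\<Sum>i\<in>F0. (norm (?c i))\<^sup>2) ?T \<le> \<delta>"
    using has_sum_finite_approximation[OF has_sum_infsum[OF summ] \<delta>] by blast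
  have tail: "(\<Sum>i\<in>X. (norm (?c i))\<^sup>2) \<le> \<delta>" if X: "finite X" "X \<subseteq> I" "X \<inter> F0 = {}" for X
  proof -
    have "(\<Sum>i\<in>X \<union> F0. (norm (?c i))\<^sup>2) \<le> ?T"
      using summ X F0 by (intro finite_sum_le_infsum) auto
    then have "(\<Sum>i\<in>X. (norm (?c i))\<^sup>2) + (\<Sum>i\<in>F0. (norm (?c i))\<^sup>2) \<le> ?T"
      using X F0 by (simp add: sum.union_disjoint)
    then show ?thesis using F0(3) by (simp add: dist_real_def)
  qed
  have "L2_norm (\<lambda>x. f x - (\<Sum>i\<in>S. ?c i * gs i x)) < e"
    if S: "finite S" "F0 \<subseteq> S" "S \<subseteq> I" for S
  proof -
    let ?s = "\<lambda>x. \<Sum>i\<in>S. ?c i * gs i x"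
    let ?v = "\<lambda>x. f x - ?s x"
    let ?d = "\<lambda>i. cnj (L2_inner ?v (gs i))"
    have s: "?s \<in> L2" using S gL2 by (intro L2_sum L2_scale) auto
    have v: "?v \<in> L2" by (intro L2_diff f s)
    have "L2_inner ?s ?v = (\<Sum>i\<in>S. ?c i * ?d i)"
      using S gL2 v by (subst L2_inner_sum_left)
        (auto intro: L2_scale simp: L2_inner_scale_left L2_inner_cnj)
    then have vv: "complex_of_real ((L2_norm ?v)\<^sup>2) = L2_inner f ?v - (\<Sum>i\<in>S. ?c i * ?d i)"
      unfolding L2_inner_self[symmetric] using L2_inner_diff_left[OF f s v] by simp
    \<comment> \<open>Cauchy-Schwarz splits the sum into coefficients of \<open>f\<close>, which are
      small outside \<open>F0\<close>, and coefficients of the residual, which the Bessel bound of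
      \<open>gs\<close> controls.\<close>
    have bnd: "norm (\<Sum>i\<in>X. ?c i * ?d i) \<le> sqrt \<delta> * (sqrt C * L2_norm ?v)"
      if X: "finite X" "X \<subseteq> I" "X \<inter> F0 = {}" for X
    proof -
      have "norm (\<Sum>i\<in>X. ?c i * ?d i) \<le> (\<Sum>i\<in>X. \<bar>norm (?c i)\<bar> * \<bar>norm (L2_inner ?v (gs i))\<bar>)"
        by (rule sum_norm_le) (simp add: norm_mult)
      also have "\<dots> \<le> L2_set (\<lambda>i. norm (?c i)) X * L2_set (\<lambda>i. norm (L2_inner ?v (gs i))) X"
        by (rule L2_set_mult_ineq)
      also have "\<dots> \<le> sqrt \<delta> * sqrt (C * (L2_norm ?v)\<^sup>2)"
        unfolding L2_set_def using tail[OF X] C(2)[OF v X(1,2)]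
        by (intro mult_mono real_sqrt_le_mono) (auto intro!: sum_nonneg less_imp_le[OF \<delta>])
      also have "sqrt (C * (L2_norm ?v)\<^sup>2) = sqrt C * L2_norm ?v"
        by (simp add: real_sqrt_mult L2_norm_nonneg)
      finally show ?thesis .
    qed
    \<comment> \<open>By \<open>vv\<close> the squared norm of the residual is the full weak sum
      minus the part over \<open>S\<close>. Approximating the full sum over a finite set that
      contains \<open>S\<close>, with error \<open>\<epsilon>\<close>, leaves only indices outside
      \<open>S\<close>, where \<open>bnd\<close> applies.\<close>
    have "(L2_norm ?v)\<^sup>2 \<le> sqrt \<delta> * (sqrt C * L2_norm ?v) + \<epsilon>" if "\<epsilon> > 0" for \<epsilon>
    proof -
      define q where "q X = (\<Sum>i\<in>X. ?c i * ?d i)" for X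
      define l where "l = L2_inner f ?v"
      have "\<forall>\<^sub>F X in finite_subsets_at_top I. dist (q X) l < \<epsilon>"
        using weak[OF f v] \<open>\<epsilon> > 0\<close> unfolding has_sum_def q_def l_def by (rule tendstoD)
      then obtain X0 where X0: "finite X0 \<and> X0 \<subseteq> I \<and>
          (\<forall>X. finite X \<and> X0 \<subseteq> X \<and> X \<subseteq> I \<longrightarrow> dist (q X) l < \<epsilon>)"
        unfolding eventually_finite_subsets_at_top by (rule exE)
      have "finite (X0 \<union> S) \<and> X0 \<subseteq> X0 \<union> S \<and> X0 \<union> S \<subseteq> I" using X0 S by simp
      then have "dist (q (X0 \<union> S)) l < \<epsilon>" using X0 by presburger
      moreover have "q (X0 \<union> S) = q ((X0 - S) \<union> S)" by simp
      moreover have "q ((X0 - S) \<union> S) = q (X0 - S) + q S"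
        unfolding q_def using X0 S(1) by (intro sum.union_disjoint) auto
      ultimately have "dist l (q S + q (X0 - S)) < \<epsilon>"
        by (simp only: dist_commute add.commute)
      then have "norm (l - q S - q (X0 - S)) < \<epsilon>"
        by (simp only: dist_norm diff_diff_eq)
      then have "norm (complex_of_real ((L2_norm ?v)\<^sup>2) - q (X0 - S)) < \<epsilon>"
        unfolding vv l_def q_def .
      moreover have "norm (q (X0 - S)) \<le> sqrt \<delta> * (sqrt C * L2_norm ?v)"
        unfolding q_def using X0 S(2) by (intro bnd) auto
      ultimately have "norm (complex_of_real ((L2_norm ?v)\<^sup>2)) \<le> sqrt \<delta> * (sqrt C * L2_norm ?v) + \<epsilon>"
        using norm_triangle_sub[of "complex_of_real ((L2_norm ?v)\<^sup>2)" "q (X0 - S)"]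
        by linarith
      then show ?thesis by (simp only: norm_of_real abs_power2)
    qed
    then have le: "(L2_norm ?v)\<^sup>2 \<le> sqrt \<delta> * (sqrt C * L2_norm ?v)"
      by (rule field_le_epsilon)
    have "L2_norm ?v \<le> sqrt (\<delta> * C)"
    proof (cases "L2_norm ?v = 0")
      case True then show ?thesis using \<delta> C(1) by simp
    next
      case False
      then have "L2_norm ?v > 0" using L2_norm_nonneg[of ?v] by linarith
      then show ?thesis using le by (simp add: power2_eq_square real_sqrt_mult flip: mult.assoc)
    qed
    also have "\<delta> * C = e\<^sup>2 / 2" using C(1) by (simp add: \<delta>_def)
    also have "sqrt (e\<^sup>2 / 2) < sqrt (e\<^sup>2)" using e by (intro real_sqrt_less_mono) simp
    also have "\<dots> = e" using e by simp
    finally show ?thesis .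
  qed
  then show "\<exists>F0. finite F0 \<and> F0 \<subseteq> I \<and> (\<forall>S. finite S \<and> F0 \<subseteq> S \<and> S \<subseteq> I \<longrightarrow>
      L2_norm (\<lambda>x. f x - (\<Sum>i\<in>S. ?c i * gs i x)) < e)"
    using F0 by blast
qed

subsection \<open>Integer translates of a cube\<close>

text \<open>Half-open, so that its integer points are exactly one representative of each residue
  class modulo \<open>N\<close>.\<close>

definition hbox :: "nat \<Rightarrow> (real^'d) set" where
  "hbox N = {x. \<forall>j. 0 \<le> x $ j \<and> x $ j < real N}"

lemma finite_hbox_Zvec: "finite (hbox N \<inter> Zvec)"
  by (rule finite_subset[OF _ finite_Zvec_bounded[of "real N"]]) (auto simp: hbox_def abs_le_iff less_imp_le intro: order_trans[of _ 0])

lemma card_hbox_Zvec: "card (hbox N \<inter> Zvec :: (real^'d) set) = N ^ CARD('d)"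
proof -
  let ?v = "\<lambda>f::'d \<Rightarrow> nat. (\<chi> j. real (f j))"
  let ?P = "PiE UNIV (\<lambda>_::'d. {..<N})"
  have "hbox N \<inter> Zvec = ?v ` ?P"
  proof (intro equalityI subsetI)
    fix r :: "real^'d" assume r: "r \<in> hbox N \<inter> Zvec"
    have fl: "real (nat \<lfloor>r $ j\<rfloor>) = r $ j" for j
      using r by (auto simp: hbox_def Zvec_def elim!: Ints_cases[of "r $ j"] dest!: spec[of _ j])
    have "nat \<lfloor>r $ j\<rfloor> < N" for j
    proof -
      have "real (nat \<lfloor>r $ j\<rfloor>) < real N" unfolding fl using r by (auto simp: hbox_def)
      then show ?thesis by simp
    qed
    moreover have "r = ?v (\<lambda>j. nat \<lfloor>r $ j\<rfloor>)" by (simp add: vec_eq_iff fl)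
    ultimately show "r \<in> ?v ` ?P" by (intro image_eqI[where x = "\<lambda>j. nat \<lfloor>r $ j\<rfloor>"]) auto
  qed (auto simp: hbox_def Zvec_def)
  moreover have "inj_on ?v ?P" by (auto simp: inj_on_def vec_eq_iff)
  ultimately show ?thesis by (simp add: card_image card_PiE)
qed

text \<open>Both \<open>n\<close> and \<open>N\<close> are integral, so rounding the coordinates of
  \<open>x\<close> down affects neither inequality.\<close>

lemma mem_hbox_translate:
  assumes "n \<in> Zvec"
  shows "x - n \<in> hbox N \<longleftrightarrow> vfloor x - n \<in> hbox N \<inter> Zvec"
proof -
  have "0 \<le> x $ j - n $ j \<and> x $ j - n $ j < real N \<longleftrightarrow>
      0 \<le> of_int \<lfloor>x $ j\<rfloor> - n $ j \<and> of_int \<lfloor>x $ j\<rfloor> - n $ j < real N" for j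
  proof -
    obtain k where k: "n $ j = of_int k" using assms by (auto simp: Zvec_def elim: Ints_cases)
    have "0 \<le> x $ j - n $ j \<longleftrightarrow> k \<le> \<lfloor>x $ j\<rfloor>" unfolding k by (simp add: le_floor_iff)
    moreover have "x $ j - n $ j < real N \<longleftrightarrow> \<lfloor>x $ j\<rfloor> < int N + k"
      unfolding k by (simp add: floor_less_iff algebra_simps)
    moreover have "0 \<le> of_int \<lfloor>x $ j\<rfloor> - n $ j \<longleftrightarrow> k \<le> \<lfloor>x $ j\<rfloor>" unfolding k by simp
    moreover have "of_int \<lfloor>x $ j\<rfloor> - n $ j < real N \<longleftrightarrow> \<lfloor>x $ j\<rfloor> < int N + k"
      unfolding k by linarith
    ultimately show ?thesis by blast
  qed
  then show ?thesis
    using Zvec_diff[OF vfloor_Zvec assms] by (simp add: hbox_def vfloor_def)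
qed

text \<open>The substitution \<open>n = vfloor x - r\<close> matches the translates of the box that
  contain \<open>x\<close> with the integer points \<open>r\<close> of the box; what remains is the
  fractional part of \<open>x\<close> plus \<open>r\<close>.\<close>

lemma sum_hbox_translates:
  fixes \<phi> :: "real^'d \<Rightarrow> 'b::comm_monoid_add"
  assumes off: "\<And>y. y \<notin> hbox N \<Longrightarrow> \<phi> y = 0"
    and S: "finite S" "S \<subseteq> Zvec" "(\<lambda>r. vfloor x - r) ` (hbox N \<inter> Zvec) \<subseteq> S"
  shows "(\<Sum>n\<in>S. \<phi> (x - n)) = (\<Sum>r\<in>hbox N \<inter> Zvec. \<phi> (x - vfloor x + r))"
proof -
  let ?I = "(\<lambda>r. vfloor x - r) ` (hbox N \<inter> Zvec)"
  have "(\<Sum>n\<in>S. \<phi> (x - n)) = (\<Sum>n\<in>?I. \<phi> (x - n))"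
  proof (rule sum.mono_neutral_right)
    show "\<forall>n\<in>S - ?I. \<phi> (x - n) = 0"
    proof
      fix n assume n: "n \<in> S - ?I"
      have "vfloor x - n \<notin> hbox N \<inter> Zvec"
      proof
        assume "vfloor x - n \<in> hbox N \<inter> Zvec"
        then have "n \<in> ?I" by (intro image_eqI[where x = "vfloor x - n"]) auto
        with n show False by blast
      qed
      then have "x - n \<notin> hbox N" using mem_hbox_translate[of n x N] n S by blast
      then show "\<phi> (x - n) = 0" by (rule off)
    qed
  qed (use S in auto)
  also have "\<dots> = (\<Sum>r\<in>hbox N \<inter> Zvec. \<phi> (x - vfloor x + r))"
    by (subst sum.reindex) (auto simp: inj_on_def o_def algebra_simps)
  finally show ?thesis .
qed

text \<open>Adding to \<open>S\<close> all translates that contain \<open>x\<close> can only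
  increase a sum of nonnegative terms, and then the exact formula with \<open>N^d\<close> terms is
  available.\<close>

lemma sum_hbox_translates_le:
  fixes \<phi> :: "real^'d \<Rightarrow> real"
  assumes off: "\<And>y. y \<notin> hbox N \<Longrightarrow> \<phi> y = 0" and b: "\<And>y. 0 \<le> \<phi> y" "\<And>y. \<phi> y \<le> C"
    and S: "finite S" "S \<subseteq> Zvec"
  shows "(\<Sum>n\<in>S. \<phi> (x - n)) \<le> real N ^ CARD('d) * C"
proof -
  let ?S = "S \<union> (\<lambda>r. vfloor x - r) ` (hbox N \<inter> Zvec)"
  have "(\<Sum>n\<in>S. \<phi> (x - n)) \<le> (\<Sum>n\<in>?S. \<phi> (x - n))"
    using S finite_hbox_Zvec[where 'a='d] b(1) by (intro sum_mono2) auto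
  also have "\<dots> = (\<Sum>r\<in>hbox N \<inter> Zvec. \<phi> (x - vfloor x + r))"
    using S finite_hbox_Zvec[where 'a='d] Zvec_diff[OF vfloor_Zvec]
    by (intro sum_hbox_translates off) auto
  also have "\<dots> \<le> (\<Sum>r\<in>(hbox N \<inter> Zvec :: (real^'d) set). C)" by (intro sum_mono b)
  also have "\<dots> = real N ^ CARD('d) * C" by (simp add: card_hbox_Zvec)
  finally show ?thesis by simp
qed

section \<open>Discrete orthogonality modulo N\<close>

lemma trig_term_add: "trig_term N k (x + y) = trig_term N k x * trig_term N k y"
  by (simp add: trig_term_def inner_add_right add_divide_distrib distrib_left exp_add)

lemma trig_term_Ints:
  assumes "k \<bullet> x / real N \<in> \<int>"
  shows "trig_term N k x = 1"
  using assms unfolding trig_term_def by (elim Ints_cases) (auto intro: exp_integer_2pi simp: mult_ac)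

text \<open>If some \<open>k $ j\<close> is not divisible by \<open>N\<close>, a cyclic shift of the
  j-th coordinate permutes the residues and multiplies every term by the same
  \<open>z \<noteq> 1\<close>, so the sum is \<open>0\<close>. Otherwise every term is 1.\<close>

lemma sum_trig_term_hbox:
  fixes k :: "real^'d"
  assumes k: "k \<in> Zvec" and N: "N \<ge> 1"
  shows "(\<Sum>r\<in>hbox N \<inter> Zvec. trig_term N k r) = (if \<forall>j. k $ j / real N \<in> \<int> then of_nat N ^ CARD('d) else 0)"
proof (cases "\<forall>j. k $ j / real N \<in> \<int>")
  case True
  have "trig_term N k r = 1" if "r \<in> Zvec" for r
  proof (rule trig_term_Ints)
    have "k \<bullet> r / real N = (\<Sum>j\<in>UNIV. k $ j / real N * r $ j)"
      by (simp add: inner_vec_def sum_divide_distrib)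
    also have "\<dots> \<in> \<int>" using True that unfolding Zvec_def mem_Collect_eq by (intro Ints_sum Ints_mult) blast+
    finally show "k \<bullet> r / real N \<in> \<int>" .
  qed
  then show ?thesis using True by (simp add: card_hbox_Zvec)
next
  case False
  then obtain j where j: "k $ j / real N \<notin> \<int>" by blast
  define z where "z = trig_term N k (axis j 1)"
  \<comment> \<open>cyclic shift of the \<open>j\<close>-th coordinate modulo \<open>N\<close>\<close>
  define \<sigma> :: "real^'d \<Rightarrow> real^'d" where
    "\<sigma> r = (if r $ j = real N - 1 then r + axis j 1 - axis j (real N) else r + axis j 1)" for r
  let ?R = "hbox N \<inter> Zvec :: (real^'d) set"
  \<comment> \<open>Wrapping around subtracts \<open>N\<close> in one coordinate and leaves the
    character of an integral \<open>k\<close> unchanged, so both branches of \<open>\<sigma>\<close>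
    multiply by \<open>z\<close>.\<close>
  have tN: "trig_term N k (- axis j (real N)) = 1"
    using k N by (intro trig_term_Ints) (auto simp: inner_axis Zvec_def)
  have "\<sigma> r \<in> ?R" if r: "r \<in> ?R" for r
  proof -
    have "r $ i \<in> \<int>" "0 \<le> r $ i" "r $ i < real N" for i using r by (auto simp: hbox_def Zvec_def)
    moreover have "r $ j + 1 < real N" if "r $ j \<noteq> real N - 1"
    proof -
      obtain a where a: "r $ j = of_int a" using \<open>r $ j \<in> \<int>\<close> by (auto elim: Ints_cases)
      have "a < int N" using \<open>r $ j < real N\<close> a by linarith
      moreover have "a \<noteq> int N - 1" using that a by auto
      ultimately have "a + 1 < int N" by linarith
      then show ?thesis unfolding a by linarith
    qed
    ultimately show ?thesis
      using N by (auto simp: \<sigma>_def hbox_def Zvec_def axis_def add_nonneg_nonneg)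
  qed
  moreover have inj: "inj_on \<sigma> ?R"
  proof (rule inj_onI)
    fix r s assume rs: "r \<in> ?R" "s \<in> ?R" "\<sigma> r = \<sigma> s"
    have eq: "\<sigma> r $ i = \<sigma> s $ i" for i using rs(3) by simp
    have b: "0 \<le> r $ j" "r $ j < real N" "0 \<le> s $ j" "s $ j < real N" using rs by (auto simp: hbox_def)
    have "r $ i = s $ i" for i
    proof (cases "i = j")
      case True
      then show ?thesis using eq[of j] b by (auto simp: \<sigma>_def split: if_splits)
    next
      case False
      then show ?thesis using eq[of i] by (auto simp: \<sigma>_def axis_def split: if_splits)
    qed
    then show "r = s" by (simp add: vec_eq_iff)
  qed
  ultimately have img: "\<sigma> ` ?R = ?R"
    using finite_hbox_Zvec by (intro endo_inj_surj) auto
  have sh: "trig_term N k (\<sigma> r) = z * trig_term N k r" for r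
    using tN by (auto simp: \<sigma>_def z_def trig_term_add diff_conv_add_uminus simp del: add_uminus_conv_diff)
  have "(\<Sum>r\<in>?R. trig_term N k r) = (\<Sum>r\<in>\<sigma> ` ?R. trig_term N k r)" by (simp only: img)
  also have "\<dots> = (\<Sum>r\<in>?R. z * trig_term N k r)" by (subst sum.reindex[OF inj]) (simp add: sh)
  also have "\<dots> = z * (\<Sum>r\<in>?R. trig_term N k r)" by (simp only: sum_distrib_left)
  finally have "(z - 1) * (\<Sum>r\<in>?R. trig_term N k r) = 0"
    by algebra
  moreover have "z \<noteq> 1"
  proof
    assume "z = 1"
    then have "exp (2 * pi * \<i> * complex_of_real (k $ j / real N)) = 1"
      by (simp add: z_def trig_term_def inner_axis)
    then obtain n :: int where "2 * pi * (k $ j / real N) = of_int (2 * n) * pi"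
      unfolding exp_eq_1 by auto
    then have "(2 * pi) * (k $ j / real N) = (2 * pi) * of_int n" by simp
    then have "k $ j / real N = of_int n" by (metis mult_cancel_left mult_eq_0_iff pi_neq_zero zero_neq_numeral)
    with j show False by simp
  qed
  ultimately have "(\<Sum>r\<in>?R. trig_term N k r) = 0" by simp
  then show ?thesis using False by (simp only: if_False)
qed

text \<open>Interchanging the sums keeps only the frequencies divisible by \<open>N\<close>. There
  the condition on \<open>c\<close> removes all but \<open>k = 0\<close>, whose coefficient
  \<open>N^{-d}\<close> cancels the number of residues.\<close>

lemma sum_hbox_trig_poly:
  fixes P :: "real^'d \<Rightarrow> real" and c :: "real^'d \<Rightarrow> complex"
  assumes N: "N \<ge> 1"
    and P: "\<forall>x. complex_of_real (P x) =
           (\<Sum>k\<in>{k\<in>Zvec. \<forall>j. \<bar>k $ j\<bar> \<le> real K}. c k * trig_term N k x)"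
    and c: "\<forall>k\<in>{k\<in>Zvec. \<forall>j. \<bar>k $ j\<bar> \<le> real K}. (\<forall>j. k $ j / real N \<in> \<int>) \<longrightarrow>
           c k = (if k = 0 then 1 / (of_nat N) ^ CARD('d) else 0)"
  shows "(\<Sum>r\<in>hbox N \<inter> Zvec. P (y + r)) = 1"
proof -
  let ?K = "{k\<in>Zvec. \<forall>j. \<bar>k $ j\<bar> \<le> real K} :: (real^'d) set"
  have "complex_of_real (\<Sum>r\<in>hbox N \<inter> Zvec. P (y + r))
      = (\<Sum>r\<in>hbox N \<inter> Zvec. \<Sum>k\<in>?K. c k * trig_term N k (y + r))"
    using P by simp
  also have "\<dots> = (\<Sum>k\<in>?K. c k * trig_term N k y * (\<Sum>r\<in>hbox N \<inter> Zvec. trig_term N k r))"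
    by (subst sum.swap) (simp add: trig_term_add sum_distrib_left mult_ac)
  also have "\<dots> = (\<Sum>k\<in>?K. if k = 0 then 1 else 0)"
  proof (rule sum.cong)
    fix k :: "real^'d" assume k: "k \<in> ?K"
    show "c k * trig_term N k y * (\<Sum>r\<in>hbox N \<inter> Zvec. trig_term N k r) = (if k = 0 then 1 else 0)"
    proof (cases "\<forall>j. k $ j / real N \<in> \<int>")
      case True
      then have ck: "c k = (if k = 0 then 1 / of_nat N ^ CARD('d) else 0)" using c k by blast
      show ?thesis
      proof (cases "k = 0")
        case True
        then show ?thesis using ck N sum_trig_term_hbox[of k N] k
          by (simp add: trig_term_def)
      qed (simp add: ck)
    next
      case False
      then have "(\<Sum>r\<in>hbox N \<inter> Zvec. trig_term N k r) = 0"
        using sum_trig_term_hbox[of k N] k N by simp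
      moreover have "k \<noteq> 0" using False by auto
      ultimately show ?thesis by simp
    qed
  qed simp
  also have "\<dots> = 1"
  proof -
    have "finite ?K" by (rule finite_Zvec_bounded)
    moreover have "0 \<in> ?K" by (simp add: Zvec_0)
    ultimately show ?thesis by (subst sum.delta) auto
  qed
  finally show ?thesis by (metis of_real_eq_1_iff)
qed

subsection \<open>Gabor systems\<close>

text \<open>Collects what duality needs from \<open>g\<close> and \<open>h\<close>. Vanishing is
  demanded off the open cube, since the separation condition excludes only dual lattice vectors
  strictly inside \<open>(-N, N)^d\<close>.\<close>

definition window :: "nat \<Rightarrow> real \<Rightarrow> (real^'d \<Rightarrow> complex) \<Rightarrow> bool" where
  "window N C w \<longleftrightarrow> w \<in> borel_measurable lebesgue \<and> (\<forall>x. norm (w x) \<le> C) \<and>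
     (\<forall>x. \<not> (\<forall>j. 0 < x $ j \<and> x $ j < real N) \<longrightarrow> w x = 0)"

lemma gabor_apply: "gabor B w (m, n) = (\<lambda>x. echar (B *v m) x * w (x - n))"
  by (simp add: gabor_def modul_def transl_def echar_def)

lemma window_eq_0:
  assumes "window N C w" "y \<notin> hbox N"
  shows "w y = 0"
proof -
  have "\<not> (\<forall>j. 0 < y $ j \<and> y $ j < real N)"
    using assms(2) unfolding hbox_def mem_Collect_eq by (metis less_imp_le)
  then show ?thesis using assms(1) by (simp add: window_def)
qed

lemma window_translate_measurable:
  "window N C w \<Longrightarrow> (\<lambda>x. w (x - n)) \<in> borel_measurable lebesgue"
  using borel_measurable_translation[of w "- n"] by (simp add: window_def)

lemma L2_translate:
  assumes "f \<in> L2"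
  shows "(\<lambda>x. f (x - n)) \<in> L2"
  using borel_measurable_translation[OF L2_measurable[OF assms], of "- n"] L2_integrable[OF assms]
    integrable_translation_iff[OF borel_measurable_integrable[OF L2_integrable[OF assms]], of "- n"]
  by (simp add: L2_def)

lemma gabor_L2:
  fixes w :: "real^'d \<Rightarrow> complex"
  assumes "window N C w"
  shows "gabor B w (m, n) \<in> L2"
proof -
  have "w \<in> L2"
  proof (rule L2_I_bound)
    show "w \<in> borel_measurable lebesgue" using assms by (simp add: window_def)
    show "integrable lebesgue (\<lambda>x::real^'d. C\<^sup>2 * indicator (cbox 0 (\<chi> j. real N)) x :: real)"
      using lmeasurable_cbox[of "0::real^'d" "\<chi> j. real N"]
      by (intro integrable_mult_right integrable_real_indicator) (auto simp: fmeasurable_def)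
    show "(norm (w x))\<^sup>2 \<le> C\<^sup>2 * indicator (cbox 0 (\<chi> j. real N)) x" for x
    proof (cases "x \<in> cbox 0 (\<chi> j. real N)")
      case True
      then show ?thesis using assms by (auto simp: window_def intro!: power_mono)
    next
      case False
      then obtain j where "\<not> (0 \<le> x $ j \<and> x $ j \<le> real N)" by (auto simp: mem_box_cart)
      then have "\<not> (\<forall>j. 0 < x $ j \<and> x $ j < real N)" by (metis less_imp_le)
      then show ?thesis using assms by (simp add: window_def)
    qed
  qed
  then show ?thesis unfolding gabor_apply
    by (intro L2_mult_bounded[where C = 1] L2_translate borel_measurable_echar) (auto simp: norm_echar)
qed

lemma L2_mult_window:
  assumes "f \<in> L2" "window N C w"
  shows "(\<lambda>x. f x * cnj (w (x - n))) \<in> L2"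
proof -
  have "(\<lambda>x. cnj (w (x - n))) \<in> borel_measurable lebesgue"
    by (rule measurable_compose[OF window_translate_measurable[OF assms(2)]
        borel_measurable_continuous_onI]) (intro continuous_intros)
  then have "(\<lambda>x. cnj (w (x - n)) * f x) \<in> L2"
    using assms by (intro L2_mult_bounded[where C = C]) (auto simp: window_def)
  then show ?thesis by (simp add: mult.commute)
qed

text \<open>The coefficient of \<open>f\<close> at \<open>(m, n)\<close> is the Fourier coefficient
  at \<open>B m\<close> of \<open>f\<close> times the conjugate of the shifted window. For fixed
  \<open>n\<close> these products live on \<open>n\<close> plus the open cube, where
  \<open>sep\<close> rules out two points that differ by a nonzero dual lattice vector.\<close>

lemma gabor_parseval:
  fixes B :: "real^'d^'d"
  assumes B: "invertible B"
    and sep: "\<forall>n\<in>Zvec. n \<noteq> 0 \<longrightarrow> \<not> (\<forall>j. \<bar>(matrix_inv (transpose B) *v n) $ j\<bar> < real N)"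
    and w: "window N C w" and v: "window N D v" and f: "f \<in> L2" and u: "u \<in> L2"
  shows "((\<lambda>m. L2_inner f (gabor B w (m, n)) * cnj (L2_inner u (gabor B v (m, n)))) has_sum
     (LINT x|lebesgue. f x * cnj (u x) * (cnj (w (x - n)) * v (x - n))) / \<bar>det B\<bar>) Zvec"
proof -
  let ?A = "(+) n ` box 0 (\<chi> j. real N)"
  let ?F = "\<lambda>x. f x * cnj (w (x - n))" and ?U = "\<lambda>x. u x * cnj (v (x - n))"
  have A: "x \<in> ?A \<longleftrightarrow> (\<forall>j. 0 < (x - n) $ j \<and> (x - n) $ j < real N)" for x
  proof
    assume "\<forall>j. 0 < (x - n) $ j \<and> (x - n) $ j < real N"
    then show "x \<in> ?A" by (intro image_eqI[where x = "x - n"]) (auto simp: mem_box_cart)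
  qed (auto simp: mem_box_cart)
  have sum: "((\<lambda>m. (LINT x|lebesgue. ?F x * cnj (echar (B *v m) x)) * cnj (LINT x|lebesgue. ?U x * cnj (echar (B *v m) x)))
     has_sum (L2_inner ?F ?U / \<bar>det B\<bar>)) Zvec"
  proof (rule parseval_lattice[OF B, where A = ?A])
    show "bounded ?A" by (intro bounded_translation bounded_box)
    show "k = 0" if "x \<in> ?A" "y \<in> ?A" "k \<in> Zvec" "x - y = matrix_inv (transpose B) *v k" for x y k
    proof (rule ccontr)
      assume "k \<noteq> 0"
      have "\<bar>(matrix_inv (transpose B) *v k) $ j\<bar> < real N" for j
      proof -
        have "0 < (x - n) $ j \<and> (x - n) $ j < real N" "0 < (y - n) $ j \<and> (y - n) $ j < real N"
          using that(1,2) unfolding A by blast+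
        then have "\<bar>(x - y) $ j\<bar> < real N" unfolding vector_minus_component by linarith
        then show ?thesis unfolding that(4) .
      qed
      with sep that(3) \<open>k \<noteq> 0\<close> show False by blast
    qed
    show "?F \<in> L2" "?U \<in> L2" using f u w v by (auto intro: L2_mult_window)
    show "?F x = 0" "?U x = 0" if "x \<notin> ?A" for x
      using that w v unfolding A window_def by auto
  qed
  have "L2_inner f (gabor B w (m, n)) = (LINT x|lebesgue. ?F x * cnj (echar (B *v m) x))"
    "L2_inner u (gabor B v (m, n)) = (LINT x|lebesgue. ?U x * cnj (echar (B *v m) x))" for m
    unfolding L2_inner_def gabor_apply by (simp_all add: mult_ac)
  moreover have "L2_inner ?F ?U = (LINT x|lebesgue. f x * cnj (u x) * (cnj (w (x - n)) * v (x - n)))"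
    unfolding L2_inner_def by (simp add: mult_ac)
  ultimately show ?thesis using sum by simp
qed

text \<open>For fixed \<open>n\<close>, Parseval turns the sum over \<open>m\<close> into a weighted
  integral of \<open>\<bar>f\<bar>^2\<close>. The weights add up to at most \<open>N^d C^2\<close>
  over \<open>n\<close>, because at most \<open>N^d\<close> shifted windows overlap at a
  point.\<close>

lemma gabor_bessel:
  fixes B :: "real^'d^'d"
  assumes B: "invertible B"
    and sep: "\<forall>n\<in>Zvec. n \<noteq> 0 \<longrightarrow> \<not> (\<forall>j. \<bar>(matrix_inv (transpose B) *v n) $ j\<bar> < real N)"
    and w: "window N C w"
  shows "bessel_seq (Zvec \<times> Zvec) (gabor B w)"
proof (rule bessel_seqI)
  show "gabor B w i \<in> L2" for i using gabor_L2[OF w] by (cases i) auto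
  fix f :: "real^'d \<Rightarrow> complex" and S :: "((real^'d) \<times> (real^'d)) set"
  assume f: "f \<in> L2" and S: "finite S" "S \<subseteq> Zvec \<times> Zvec"
  let ?c = "\<lambda>m n. (norm (L2_inner f (gabor B w (m, n))))\<^sup>2"
  let ?I = "\<lambda>n. LINT x|lebesgue. (norm (f x))\<^sup>2 * (norm (w (x - n)))\<^sup>2"
  have wb: "norm (w x) \<le> C" for x using w by (simp add: window_def)
  have sq: "f x * cnj (f x) * (cnj (w (x - n)) * w (x - n)) = complex_of_real ((norm (f x))\<^sup>2 * (norm (w (x - n)))\<^sup>2)" for x n
    by (simp only: of_real_mult complex_norm_square mult.commute)
  have int: "integrable lebesgue (\<lambda>x. (norm (f x))\<^sup>2 * (norm (w (x - n)))\<^sup>2)" for n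
    using L2_integrable[OF L2_mult_window[OF f w, of n]] by (simp add: norm_mult power_mult_distrib)
  have column: "(\<Sum>m\<in>X. ?c m n) \<le> ?I n / \<bar>det B\<bar>" if X: "finite X" "X \<subseteq> Zvec" for X n
  proof (rule finite_sum_le_has_sum)
    have "((\<lambda>m. L2_inner f (gabor B w (m, n)) * cnj (L2_inner f (gabor B w (m, n)))) has_sum
       complex_of_real (?I n / \<bar>det B\<bar>)) Zvec"
      using gabor_parseval[OF B sep w w f f, of n] unfolding sq
      by (simp only: integral_complex_of_real of_real_divide)
    then show "((\<lambda>m. ?c m n) has_sum ?I n / \<bar>det B\<bar>) Zvec"
      unfolding complex_norm_square[symmetric] has_sum_of_real_iff .
  qed (use X in auto)
  \<comment> \<open>Enlarging \<open>S\<close> to a rectangle separates the two summations.\<close>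
  have "(\<Sum>i\<in>S. (norm (L2_inner f (gabor B w i)))\<^sup>2) \<le>
      (\<Sum>i\<in>fst ` S \<times> snd ` S. (norm (L2_inner f (gabor B w i)))\<^sup>2)"
    using S by (intro sum_mono2) (force)+
  also have "\<dots> = (\<Sum>n\<in>snd ` S. \<Sum>m\<in>fst ` S. ?c m n)"
    by (subst sum.swap) (simp add: sum.cartesian_product)
  also have "\<dots> \<le> (\<Sum>n\<in>snd ` S. ?I n / \<bar>det B\<bar>)"
    using S by (intro sum_mono column) auto
  also have "\<dots> = (LINT x|lebesgue. (\<Sum>n\<in>snd ` S. (norm (f x))\<^sup>2 * (norm (w (x - n)))\<^sup>2)) / \<bar>det B\<bar>"
    using int by (simp add: sum_divide_distrib)
  also have "\<dots> \<le> (LINT x|lebesgue. (real N ^ CARD('d) * C\<^sup>2) * (norm (f x))\<^sup>2) / \<bar>det B\<bar>"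
  proof (intro divide_right_mono integral_mono)
    fix x
    have "(\<Sum>n\<in>snd ` S. (norm (w (x - n)))\<^sup>2) \<le> real N ^ CARD('d) * C\<^sup>2"
    proof (rule sum_hbox_translates_le[where \<phi> = "\<lambda>y. (norm (w y))\<^sup>2"])
      show "(norm (w y))\<^sup>2 = 0" if "y \<notin> hbox N" for y
        using window_eq_0[OF w that] by simp
    qed (use S wb in \<open>auto intro!: power_mono\<close>)
    then have "(norm (f x))\<^sup>2 * (\<Sum>n\<in>snd ` S. (norm (w (x - n)))\<^sup>2) \<le> (norm (f x))\<^sup>2 * (real N ^ CARD('d) * C\<^sup>2)"
      by (rule mult_left_mono) simp
    then show "(\<Sum>n\<in>snd ` S. (norm (f x))\<^sup>2 * (norm (w (x - n)))\<^sup>2) \<le> (real N ^ CARD('d) * C\<^sup>2) * (norm (f x))\<^sup>2"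
      by (simp only: sum_distrib_left mult.commute)
  qed (use int L2_integrable[OF f] in auto)
  also have "\<dots> = (real N ^ CARD('d) * C\<^sup>2 / \<bar>det B\<bar>) * (L2_norm f)\<^sup>2"
    by (simp add: L2_norm_power2)
  finally show "(\<Sum>i\<in>S. (norm (L2_inner f (gabor B w i)))\<^sup>2) \<le> (real N ^ CARD('d) * C\<^sup>2 / \<bar>det B\<bar>) * (L2_norm f)\<^sup>2" .
qed

text \<open>Dominated convergence runs along sequences, so the limit over finite subsets of
  \<open>Zvec\<close> is sampled along growing cubes.\<close>

lemma filterlim_Zvec_cubes:
  "filterlim (\<lambda>k::nat. {n\<in>Zvec. \<forall>j. \<bar>n $ j\<bar> \<le> real k} :: (real^'d) set) (finite_subsets_at_top Zvec) sequentially"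
  unfolding filterlim_finite_subsets_at_top
proof (intro allI impI)
  fix X :: "(real^'d) set" assume X: "finite X \<and> X \<subseteq> Zvec"
  then have "bounded X" by (simp add: finite_imp_bounded)
  then obtain R where R: "\<And>x. x \<in> X \<Longrightarrow> norm x \<le> R" by (auto simp: bounded_iff)
  obtain k0 :: nat where k0: "R \<le> real k0" using real_arch_simple by blast
  have "X \<subseteq> {n\<in>Zvec. \<forall>j. \<bar>n $ j\<bar> \<le> real k}" if "k \<ge> k0" for k
  proof
    fix x assume x: "x \<in> X"
    have "\<bar>x $ j\<bar> \<le> real k" for j
      using component_le_norm_cart[of x j] R[OF x] k0 that by linarith
    then show "x \<in> {n\<in>Zvec. \<forall>j. \<bar>n $ j\<bar> \<le> real k}" using X x by auto
  qed
  then show "\<forall>\<^sub>F k in sequentially. finite {n\<in>Zvec. \<forall>j. \<bar>n $ j\<bar> \<le> real k} \<and>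
      X \<subseteq> {n\<in>Zvec. \<forall>j. \<bar>n $ j\<bar> \<le> real k} \<and> {n\<in>Zvec. \<forall>j. \<bar>n $ j\<bar> \<le> real k} \<subseteq> (Zvec :: (real^'d) set)"
    unfolding eventually_sequentially using finite_Zvec_bounded by (intro exI[of _ k0]) auto
qed

text \<open>At each point only finitely many translates of \<open>q\<close> are nonzero, so the
  partial sums are eventually the constant \<open>D\<close>; counting overlaps gives the dominating
  function \<open>N^d C \<bar>a\<bar>\<close>. Convergence in \<open>sum\<close> identifies the
  limit of the integrals with \<open>s\<close>.\<close>

lemma integral_partition_of_unity:
  fixes q :: "real^'d \<Rightarrow> complex" and a :: "real^'d \<Rightarrow> complex"
  assumes a: "integrable lebesgue a" and q: "q \<in> borel_measurable lebesgue"
    and bound: "\<And>y. norm (q y) \<le> C" and off: "\<And>y. y \<notin> hbox N \<Longrightarrow> q y = 0"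
    and part: "\<And>y. y \<in> ucube \<Longrightarrow> (\<Sum>r\<in>hbox N \<inter> Zvec. q (y + r)) = D"
    and sum: "((\<lambda>n. LINT x|lebesgue. a x * q (x - n)) has_sum s) Zvec"
  shows "s = D * (LINT x|lebesgue. a x)"
proof -
  let ?Q = "\<lambda>k::nat. {n\<in>Zvec. \<forall>j. \<bar>n $ j\<bar> \<le> real k} :: (real^'d) set"
  have Q: "finite (?Q k)" "?Q k \<subseteq> Zvec" for k by (rule finite_Zvec_bounded) auto
  have qm: "(\<lambda>x. q (x - n)) \<in> borel_measurable lebesgue" for n
    using borel_measurable_translation[OF q, of "- n"] by simp
  have am: "(\<lambda>x. a x * q (x - n)) \<in> borel_measurable lebesgue" for n
    using a qm by (intro borel_measurable_times) auto
  have int: "integrable lebesgue (\<lambda>x. a x * q (x - n))" for n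
  proof (rule Bochner_Integration.integrable_bound[OF _ am])
    show "integrable lebesgue (\<lambda>x. C * norm (a x))" using a by simp
    have "norm (a x) * norm (q (x - n)) \<le> \<bar>C\<bar> * norm (a x)" for x
      using bound[of "x - n"] by (subst mult.commute) (auto intro!: mult_right_mono)
    then show "AE x in lebesgue. norm (a x * q (x - n)) \<le> norm (C * norm (a x))"
      by (auto simp: norm_mult abs_mult)
  qed
  have "(\<lambda>k. LINT x|lebesgue. (\<Sum>n\<in>?Q k. a x * q (x - n))) \<longlonglongrightarrow> (LINT x|lebesgue. D * a x)"
  proof (rule integral_dominated_convergence)
    show "integrable lebesgue (\<lambda>x. (real N ^ CARD('d) * C) * norm (a x))" using a by simp
    show "AE x in lebesgue. (\<lambda>k. \<Sum>n\<in>?Q k. a x * q (x - n)) \<longlonglongrightarrow> D * a x"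
    proof (rule AE_I2, rule tendsto_eventually)
      fix x :: "real^'d"
      let ?X = "(\<lambda>r. vfloor x - r) ` (hbox N \<inter> Zvec)"
      have "finite ?X \<and> ?X \<subseteq> Zvec"
        using finite_hbox_Zvec Zvec_diff[OF vfloor_Zvec] by auto
      from filterlim_Zvec_cubes[unfolded filterlim_finite_subsets_at_top, rule_format, OF this]
      have "\<forall>\<^sub>F k in sequentially. ?X \<subseteq> ?Q k" by (rule eventually_mono) blast
      then show "\<forall>\<^sub>F k in sequentially. (\<Sum>n\<in>?Q k. a x * q (x - n)) = D * a x"
      proof eventually_elim
        case (elim k)
        have "(\<Sum>n\<in>?Q k. q (x - n)) = D"
          using sum_hbox_translates[of N q, OF off Q elim] part[of "x - vfloor x"]
          by (simp add: mem_ucube_translate vfloor_Zvec)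
        then show ?case by (simp flip: sum_distrib_left add: mult.commute)
      qed
    qed
    show "AE x in lebesgue. norm (\<Sum>n\<in>?Q k. a x * q (x - n)) \<le> (real N ^ CARD('d) * C) * norm (a x)" for k
    proof (rule AE_I2)
      fix x
      have "norm (\<Sum>n\<in>?Q k. a x * q (x - n)) \<le> (\<Sum>n\<in>?Q k. norm (a x) * norm (q (x - n)))"
        by (rule sum_norm_le) (simp add: norm_mult)
      also have "\<dots> = norm (a x) * (\<Sum>n\<in>?Q k. norm (q (x - n)))" by (simp only: sum_distrib_left)
      also have "\<dots> \<le> norm (a x) * (real N ^ CARD('d) * C)"
        using off bound Q
        by (intro mult_left_mono sum_hbox_translates_le[where \<phi> = "\<lambda>y. norm (q y)"]) auto
      finally show "norm (\<Sum>n\<in>?Q k. a x * q (x - n)) \<le> (real N ^ CARD('d) * C) * norm (a x)"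
        by (simp only: mult.commute)
    qed
  qed (use a am in auto)
  then have "(\<lambda>k. \<Sum>n\<in>?Q k. LINT x|lebesgue. a x * q (x - n)) \<longlonglongrightarrow> D * (LINT x|lebesgue. a x)"
    using int by simp
  moreover have "(\<lambda>k. \<Sum>n\<in>?Q k. LINT x|lebesgue. a x * q (x - n)) \<longlonglongrightarrow> s"
    using sum unfolding has_sum_def by (rule filterlim_compose[OF _ filterlim_Zvec_cubes])
  ultimately show ?thesis by (rule LIMSEQ_unique[symmetric])
qed

lemma bessel_seq_summable:
  "bessel_seq I fs \<Longrightarrow> f \<in> L2 \<Longrightarrow> (\<lambda>i. (norm (L2_inner f (fs i)))\<^sup>2) summable_on I"
  by (auto simp: bessel_seq_def)

text \<open>The sum over pairs is taken first over \<open>m\<close>, where Parseval yields an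
  integral against the n-th translate of \<open>cnj h * g\<close>, and then over \<open>n\<close>,
  where \<open>part\<close> applies. The value \<open>\<bar>det B\<bar>\<close> in
  \<open>part\<close> cancels the factor \<open>1 / \<bar>det B\<bar>\<close> from Parseval.\<close>

lemma gabor_dual_frames:
  fixes B :: "real^'d^'d"
  assumes B: "invertible B"
    and sep: "\<forall>n\<in>Zvec. n \<noteq> 0 \<longrightarrow> \<not> (\<forall>j. \<bar>(matrix_inv (transpose B) *v n) $ j\<bar> < real N)"
    and g: "window N C g" and h: "window N D h"
    and part: "\<And>y. y \<in> ucube \<Longrightarrow> (\<Sum>r\<in>hbox N \<inter> Zvec. cnj (h (y + r)) * g (y + r)) = \<bar>det B\<bar>"
  shows "dual_frames (Zvec \<times> Zvec) (gabor B g) (gabor B h)"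
proof (rule dual_frames_weakI)
  show bg: "bessel_seq (Zvec \<times> Zvec) (gabor B g)" and bh: "bessel_seq (Zvec \<times> Zvec) (gabor B h)"
    using gabor_bessel[OF B sep] g h by blast+
  fix f u :: "real^'d \<Rightarrow> complex" assume f: "f \<in> L2" and u: "u \<in> L2"
  let ?t = "\<lambda>i. L2_inner f (gabor B h i) * cnj (L2_inner u (gabor B g i))"
  let ?q = "\<lambda>y. cnj (h y) * g y"
  \<comment> \<open>Both coefficient families are square-summable by the Bessel property, so their
    product is absolutely summable.\<close>
  have "(\<lambda>i. norm (?t i)) summable_on (Zvec \<times> Zvec)"
  proof (rule Infinite_Sum.abs_summable_product)
    show "(\<lambda>i. norm (L2_inner f (gabor B h i) * L2_inner f (gabor B h i))) summable_on (Zvec \<times> Zvec)"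
      using bessel_seq_summable[OF bh f] by (simp add: norm_mult power2_eq_square)
    show "(\<lambda>i. norm (cnj (L2_inner u (gabor B g i)) * cnj (L2_inner u (gabor B g i)))) summable_on (Zvec \<times> Zvec)"
      using bessel_seq_summable[OF bg u] by (simp add: norm_mult power2_eq_square)
  qed
  then have "?t summable_on (Zvec \<times> Zvec)" by (rule Infinite_Sum.abs_summable_summable)
  then obtain s where s: "(?t has_sum s) (Zvec \<times> Zvec)" unfolding summable_on_def by blast
  \<comment> \<open>The pairs are flipped so that \<open>m\<close> becomes the inner summation
    index.\<close>
  then have "((\<lambda>(n, m). ?t (m, n)) has_sum s) (Zvec \<times> Zvec)"
    by (subst (asm) has_sum_swap)
  then have "((\<lambda>n. (LINT x|lebesgue. f x * cnj (u x) * ?q (x - n)) / \<bar>det B\<bar>) has_sum s) Zvec"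
    by (rule has_sum_SigmaD) (use gabor_parseval[OF B sep h g f u] in simp)
  then have "((\<lambda>n. complex_of_real \<bar>det B\<bar> * ((LINT x|lebesgue. f x * cnj (u x) * ?q (x - n)) / \<bar>det B\<bar>))
      has_sum complex_of_real \<bar>det B\<bar> * s) Zvec"
    by (rule has_sum_cmult_right)
  moreover have det: "det B \<noteq> 0" using B by (simp add: invertible_det_nz)
  ultimately have sum: "((\<lambda>n. LINT x|lebesgue. f x * cnj (u x) * ?q (x - n)) has_sum \<bar>det B\<bar> * s) Zvec"
    by simp
  have "complex_of_real \<bar>det B\<bar> * s = complex_of_real \<bar>det B\<bar> * (LINT x|lebesgue. f x * cnj (u x))"
  proof (rule integral_partition_of_unity[OF L2_mult_integrable[OF f u] _ _ _ part sum])
    show "?q \<in> borel_measurable lebesgue"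
    proof (rule borel_measurable_times)
      show "(\<lambda>x. cnj (h x)) \<in> borel_measurable lebesgue"
        using h by (intro measurable_compose[of h _ borel cnj] borel_measurable_continuous_onI continuous_intros)
          (simp add: window_def)
    qed (use g in \<open>simp add: window_def\<close>)
    show "norm (?q y) \<le> D * C" for y
    proof -
      have "norm (h y) \<le> D" "norm (g y) \<le> C" using g h by (auto simp: window_def)
      then show ?thesis unfolding norm_mult complex_mod_cnj
        by (meson mult_mono norm_ge_zero order_trans)
    qed
    show "?q y = 0" if "y \<notin> hbox N" for y
      using window_eq_0[OF g that] by simp
  qed
  then have "s = L2_inner f u" using det by (simp add: L2_inner_def)
  with s show "(?t has_sum L2_inner f u) (Zvec \<times> Zvec)" by simp
qed

section \<open>The windows of the theorem\<close>

lemma Ck_imp_continuous: "Ck m f \<Longrightarrow> continuous_on UNIV f"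
  by (cases m) auto

text \<open>Continuity gives measurability and, on the compact cube, boundedness. Since
  \<open>M \<ge> 1\<close> there is a zero on every face, so the cutoff to the closed cube already
  vanishes off the open one.\<close>

lemma window_sin_prod_cutoff:
  fixes T :: "real^'d \<Rightarrow> real"
  assumes T: "trig_alg T" and N: "N \<ge> 1" and M: "M \<ge> 1"
    and g_def: "g = (\<lambda>x. (\<Prod>j\<in>UNIV. sin (pi * x $ j / real N) ^ M) * T x * indicator (cbox 0 (\<chi> j. real N)) x)"
  shows "Ck (M - 1) g" "\<exists>C. window N C (\<lambda>x. complex_of_real (g x))"
proof -
  show ck: "Ck (M - 1) g"
    unfolding g_def using N M by (intro Ck_sin_prod_cutoff T) auto
  then have cont: "continuous_on UNIV g" by (rule Ck_imp_continuous)
  then have "compact (g ` cbox 0 (\<chi> j. real N))"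
    by (intro compact_continuous_image compact_cbox continuous_on_subset[OF cont]) auto
  then obtain C where C: "\<And>x. x \<in> cbox 0 (\<chi> j. real N) \<Longrightarrow> \<bar>g x\<bar> \<le> C"
    using compact_imp_bounded by (fastforce simp: bounded_iff)
  have b: "\<bar>g x\<bar> \<le> \<bar>C\<bar>" for x
  proof (cases "x \<in> cbox 0 (\<chi> j. real N)")
    case True then show ?thesis using C[OF True] by linarith
  qed (simp add: g_def)
  have off: "g x = 0" if x: "\<not> (\<forall>j. 0 < x $ j \<and> x $ j < real N)" for x
  proof (cases "x \<in> cbox 0 (\<chi> j. real N)")
    case True
    obtain j where j: "\<not> (0 < x $ j \<and> x $ j < real N)" using x by blast
    moreover have "0 \<le> x $ j" "x $ j \<le> real N" using True by (auto simp: mem_box_cart)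
    ultimately have "x $ j = 0 \<or> x $ j = real N" by linarith
    then have "(\<Prod>j\<in>UNIV. sin (pi * x $ j / real N) ^ M) = (0::real)"
      using N M sin_prod_eq_0[of x j "real N" "\<lambda>_. M"] by simp
    then show ?thesis by (simp add: g_def)
  qed (simp add: g_def)
  have "continuous_on UNIV (\<lambda>x. complex_of_real (g x))" by (intro continuous_intros cont)
  then have "(\<lambda>x. complex_of_real (g x)) \<in> borel_measurable lebesgue"
    using borel_measurable_continuous_onI[of "\<lambda>x. complex_of_real (g x)"]
    by (intro measurable_completion) simp
  then show "\<exists>C. window N C (\<lambda>x. complex_of_real (g x))"
    unfolding window_def using b off by (intro exI[of _ "\<bar>C\<bar>"]) auto
qed

theorem theorem4p1:
  fixes P G H :: "real^'d \<Rightarrow> real" and c :: "real^'d \<Rightarrow> complex"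
    and B :: "real^'d^'d" and K N M :: nat and g h :: "real^'d \<Rightarrow> real"
  assumes "CARD('d) \<ge> 2" and "N \<ge> 1" and "M \<ge> 1" and "M \<le> K"
    and "\<forall>x. complex_of_real (P x) =
           (\<Sum>k\<in>{k\<in>Zvec. \<forall>j. \<bar>k $ j\<bar> \<le> real K}. c k * trig_term N k x)"
    and "\<forall>k\<in>{k\<in>Zvec. \<forall>j. \<bar>k $ j\<bar> \<le> real K}. (\<forall>j. k $ j / real N \<in> \<int>) \<longrightarrow>
           c k = (if k = 0 then 1 / (of_nat N) ^ CARD('d) else 0)"
    and "Ck (2 * M - 1) (\<lambda>x. P x * indicator (cbox 0 (\<chi> j. real N)) x)"
    and "is_real_trig_poly N G" and "is_real_trig_poly N H"
    and "\<forall>x. P x = (\<Prod>j\<in>UNIV. sin (pi * x $ j / real N) ^ (2 * M)) * G x * H x"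
    and "invertible B"
    and "\<forall>n\<in>Zvec. n \<noteq> 0 \<longrightarrow> \<not> (\<forall>j. \<bar>(matrix_inv (transpose B) *v n) $ j\<bar> < real N)"
    and "g = (\<lambda>x. (\<Prod>j\<in>UNIV. sin (pi * x $ j / real N) ^ M) * G x * indicator (cbox 0 (\<chi> j. real N)) x)"
    and "h = (\<lambda>x. \<bar>det B\<bar> * (\<Prod>j\<in>UNIV. sin (pi * x $ j / real N) ^ M) * H x * indicator (cbox 0 (\<chi> j. real N)) x)"
  shows "Ck (M - 1) g \<and> Ck (M - 1) h \<and>
         dual_frames (Zvec \<times> Zvec) (gabor B (\<lambda>x. complex_of_real (g x))) (gabor B (\<lambda>x. complex_of_real (h x)))"
proof -
  \<comment> \<open>The constant \<open>\<bar>det B\<bar>\<close> is absorbed into the trigonometric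
    factor, so that one lemma serves both windows.\<close>
  have h: "h = (\<lambda>x. (\<Prod>j\<in>UNIV. sin (pi * x $ j / real N) ^ M) * (\<bar>det B\<bar> * H x) * indicator (cbox 0 (\<chi> j. real N)) x)"
    unfolding assms(14) by (simp add: fun_eq_iff mult_ac)
  have H: "trig_alg (\<lambda>x. \<bar>det B\<bar> * H x)"
    by (intro trig_alg.mult trig_alg.const trig_alg_real_trig_poly[OF assms(9)])
  note gw = window_sin_prod_cutoff[OF trig_alg_real_trig_poly[OF assms(8)] assms(2,3,13)]
  note hw = window_sin_prod_cutoff[OF H assms(2,3) h]
  obtain C where C: "window N C (\<lambda>x. complex_of_real (g x))" using gw(2) by blast
  obtain D where D: "window N D (\<lambda>x. complex_of_real (h x))" using hw(2) by blast
  have gh: "h x * g x = \<bar>det B\<bar> * P x" if "x \<in> cbox 0 (\<chi> j. real N)" for x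
  proof -
    have "(\<Prod>j\<in>UNIV. sin (pi * x $ j / real N) ^ (2 * M)) = (\<Prod>j\<in>UNIV. sin (pi * x $ j / real N) ^ M) * (\<Prod>j\<in>UNIV. sin (pi * x $ j / real N) ^ M)"
      by (simp add: prod.distrib[symmetric] power_add[symmetric] mult_2)
    then show ?thesis
      using that assms(10) by (simp add: assms(13) h)
  qed
  have "(\<Sum>r\<in>hbox N \<inter> Zvec. cnj (complex_of_real (h (y + r))) * complex_of_real (g (y + r))) = complex_of_real \<bar>det B\<bar>"
    if y: "y \<in> ucube" for y
  proof -
    \<comment> \<open>The integer \<open>r $ j\<close> is at most \<open>N - 1\<close> and
      \<open>y $ j < 1\<close>, so the point stays in the cube. There the indicators are 1 and
      \<open>gh\<close> replaces the product of the windows by a multiple of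
      \<open>P\<close>.\<close>
    have "y + r \<in> cbox 0 (\<chi> j. real N)" if r: "r \<in> hbox N \<inter> Zvec" for r
    proof -
      have "0 \<le> (y + r) $ j \<and> (y + r) $ j \<le> real N" for j
      proof -
        have "r $ j \<in> \<int>" "0 \<le> r $ j" "r $ j < real N" using r by (auto simp: hbox_def Zvec_def)
        from this(1) obtain a where a: "r $ j = of_int a" by (elim Ints_cases)
        have "of_int a < (of_int (int N) :: real)" using \<open>r $ j < real N\<close> a by simp
        then have "a + 1 \<le> int N" by (simp only: of_int_less_iff)
        then have "of_int a + 1 \<le> real N" by linarith
        moreover have "0 \<le> y $ j" "y $ j < 1" using y by (auto simp: ucube_def)
        ultimately show ?thesis using \<open>0 \<le> r $ j\<close> a unfolding vector_add_component by linarith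
      qed
      then show ?thesis by (simp add: mem_box_cart)
    qed
    then have "(\<Sum>r\<in>hbox N \<inter> Zvec. h (y + r) * g (y + r)) = (\<Sum>r\<in>hbox N \<inter> Zvec. \<bar>det B\<bar> * P (y + r))"
      by (intro sum.cong gh) auto
    also have "\<dots> = \<bar>det B\<bar>"
      using sum_hbox_trig_poly[OF assms(2,5,6), of y] by (simp flip: sum_distrib_left)
    finally have "complex_of_real (\<Sum>r\<in>hbox N \<inter> Zvec. h (y + r) * g (y + r)) = complex_of_real \<bar>det B\<bar>"
      by (simp only:)
    then show ?thesis by simp
  qed
  then have "dual_frames (Zvec \<times> Zvec) (gabor B (\<lambda>x. complex_of_real (g x))) (gabor B (\<lambda>x. complex_of_real (h x)))"
    by (rule gabor_dual_frames[OF assms(11,12) C D])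
  with gw(1) hw(1) show ?thesis by blast
qed

end
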